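(* Let $G$ be a finitely generated group of polynomial growth, and let $X$ be a finite generating set for $G$. Then: (i) $\operatorname{dc}_X(G)>0$ if and only if $G$ is virtually abelian; (ii) $\operatorname{dc}_X(G)>5/8$ if and only if $G$ is abelian.
   Context: Generating sets generate $G$ as a group. For a finite generating set $X$ of $G$, $|g|_X$ is the word length of $g\in G$ with respect to $X\cup X^{-1}$, and $\mathbb{B}_X(n)=\{g\in G : |g|_X\leq n\}$ is the ball of radius $n$ centered at $1$ in the Cayley graph of $G$ with respect to $X$. The degree of commutativity of $G$ with respect to $X$ is $$\operatorname{dc}_X(G)=\limsup_{n\to\infty}\frac{|\{(u,v)\in \mathbb{B}_X(n)^2 : uv=vu\}|}{|\mathbb{B}_X(n)|^2}.$$ $G$ has polynomial growth if there exist constants $D$ and $d$ such that $|\mathbb{B}_X(n)|\leq Dn^d$ for all sufficiently large $n$ (this does not depend on the finite generating set $X$). A group is virtually abelian if it has an abelian subgroup of finite index. *)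

theory Defs
  imports "HOL-Algebra.Generated_Groups" "HOL-Library.Extended_Real"
begin

definition finite_generating_set :: "('a, 'b) monoid_scheme \<Rightarrow> 'a set \<Rightarrow> bool" where
  "finite_generating_set G X \<longleftrightarrow> finite X \<and> X \<subseteq> carrier G \<and> generate G X = carrier G"

definition word_product :: "('a, 'b) monoid_scheme \<Rightarrow> 'a list \<Rightarrow> 'a" where
  "word_product G ws = foldr (\<lambda>x y. x \<otimes>\<^bsub>G\<^esub> y) ws \<one>\<^bsub>G\<^esub>"

(* Only meaningful when X generates G: otherwise the set of admissible lengths may be
   empty and LEAST is unspecified. *)
definition word_length :: "('a, 'b) monoid_scheme \<Rightarrow> 'a set \<Rightarrow> 'a \<Rightarrow> nat" where
  "word_length G X g =
     (LEAST n. \<exists>ws. length ws = n \<and> set ws \<subseteq> X \<union> m_inv G ` X \<and> word_product G ws = g)"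

definition cayley_ball :: "('a, 'b) monoid_scheme \<Rightarrow> 'a set \<Rightarrow> nat \<Rightarrow> 'a set" where
  "cayley_ball G X n = {g \<in> carrier G. word_length G X g \<le> n}"

(* The limsup is taken in the extended reals because the type real is not a complete
   lattice; the terms of the sequence lie in [0, 1] when X is a finite generating set. *)
definition degree_of_commutativity :: "('a, 'b) monoid_scheme \<Rightarrow> 'a set \<Rightarrow> ereal" where
  "degree_of_commutativity G X =
     limsup (\<lambda>n. ereal (
       real (card {(u, v). u \<in> cayley_ball G X n \<and> v \<in> cayley_ball G X n
                           \<and> u \<otimes>\<^bsub>G\<^esub> v = v \<otimes>\<^bsub>G\<^esub> u})
       / (real (card (cayley_ball G X n)))\<^sup>2))"

(* The choice of finite generating set does not matter, so it is enough to ask for the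
   bound with respect to one of them. *)
definition polynomial_growth :: "('a, 'b) monoid_scheme \<Rightarrow> bool" where
  "polynomial_growth G \<longleftrightarrow>
     (\<exists>Y. finite_generating_set G Y \<and>
       (\<exists>D d :: real. \<forall>\<^sub>F n in sequentially.
          real (card (cayley_ball G Y n)) \<le> D * real n powr d))"

definition virtually_abelian :: "('a, 'b) monoid_scheme \<Rightarrow> bool" where
  "virtually_abelian G \<longleftrightarrow>
     (\<exists>H. subgroup H G \<and> comm_group (G\<lparr>carrier := H\<rparr>) \<and> finite (rcosets\<^bsub>G\<^esub> H))"

end

theory Submission
  imports Defs "HOL-Algebra.FiniteProduct"
begin

text \<open>Polynomial growth is used only through the existence of arbitrarily large scales \<open>r\<close> at which
  the ball of radius \<open>6r\<close> is at most \<open>K\<close> times as large as the ball of radius \<open>r\<close>; Gromov's theorem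
  is not needed. If the degree of commutativity is positive, then at some large radius a positive
  proportion of the elements have a centralizer of positive density. A subgroup that is dense at one
  large radius is dense at all smaller radii, in particular at a doubling scale, and there density
  forces an index bounded independently of the subgroup. Hence many elements have a centralizer of
  finite index, so the FC-centre is itself dense and of finite index, and its centre is an abelian
  normal subgroup of finite index. Conversely an abelian subgroup of finite index is dense at the
  doubling scales.

  Once \<open>G\<close> is virtually abelian its balls are doubling at every scale, so spheres become
  negligible. A subgroup meeting \<open>m\<close> cosets within bounded distance then has density at most
  \<open>1/m\<close> asymptotically, and the classical \<open>5/8\<close> bound for finite groups carries over.\<close>

section \<open>Words, word length and balls of the Cayley graph\<close>

locale fg_group = group G for G :: "('a, 'b) monoid_scheme" (structure) +
  fixes X :: "'a set"
  assumes finite_generating_set: "finite_generating_set G X"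
begin

abbreviation letters :: "'a set" where "letters \<equiv> X \<union> m_inv G ` X"
abbreviation ball :: "nat \<Rightarrow> 'a set" where "ball \<equiv> cayley_ball G X"
abbreviation len :: "'a \<Rightarrow> nat" where "len \<equiv> word_length G X"

lemma inv_mult_cancel [simp]:
  assumes "x \<in> carrier G" "y \<in> carrier G"
  shows "inv x \<otimes> (x \<otimes> y) = y" "x \<otimes> (inv x \<otimes> y) = y"
  using assms by (simp_all add: m_assoc[symmetric])

lemma letters_closed: "letters \<subseteq> carrier G"
  using finite_generating_set by (auto simp: finite_generating_set_def)

lemma word_product_Nil [simp]: "word_product G [] = \<one>"
  and word_product_Cons [simp]: "word_product G (x # ws) = x \<otimes> word_product G ws"
  by (simp_all add: word_product_def)

lemma word_product_closed: "set ws \<subseteq> letters \<Longrightarrow> word_product G ws \<in> carrier G"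
  using letters_closed by (induction ws) auto

lemma word_product_append:
  assumes "set us \<subseteq> letters" "set ws \<subseteq> letters"
  shows "word_product G (us @ ws) = word_product G us \<otimes> word_product G ws"
  using assms(1)
proof (induction us)
  case Nil
  then show ?case using word_product_closed[OF assms(2)] by simp
next
  case (Cons u us)
  then show ?case
    using word_product_closed[OF assms(2)] word_product_closed[of us] letters_closed
    by (auto simp: m_assoc)
qed

lemma word_product_inverse:
  assumes "set ws \<subseteq> letters"
  obtains us where "length us = length ws" "set us \<subseteq> letters"
    "word_product G us = inv (word_product G ws)"
proof -
  have "\<exists>us. length us = length ws \<and> set us \<subseteq> letters \<and> word_product G us = inv (word_product G ws)"
    using assms
  proof (induction ws)
    case Nil
    then show ?case by simp
  next
    case (Cons w ws)
    then obtain us where us: "length us = length ws" "set us \<subseteq> letters"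
      "word_product G us = inv (word_product G ws)" by auto
    have w: "w \<in> carrier G" "inv w \<in> letters"
      using Cons.prems finite_generating_set letters_closed
      by (auto simp: finite_generating_set_def subset_iff)
    have "word_product G (us @ [inv w]) = inv (word_product G (w # ws))"
      using us w Cons.prems word_product_closed[of ws]
      by (subst word_product_append) (auto simp: inv_mult_group)
    then show ?case using us w by (intro exI[of _ "us @ [inv w]"]) auto
  qed
  then show ?thesis using that by blast
qed

lemma exists_word:
  assumes "g \<in> carrier G"
  shows "\<exists>ws. set ws \<subseteq> letters \<and> word_product G ws = g"
proof -
  have "g \<in> generate G X"
    using assms finite_generating_set by (simp add: finite_generating_set_def)
  then show ?thesis
  proof induction
    case one
    then show ?case by (intro exI[of _ "[]"]) simp
  next
    case (incl h)
    then show ?case using letters_closed by (intro exI[of _ "[h]"]) auto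
  next
    case (inv h)
    then show ?case using letters_closed by (intro exI[of _ "[inv h]"]) auto
  next
    case (eng g h)
    then obtain us ws where "set us \<subseteq> letters" "word_product G us = g"
      "set ws \<subseteq> letters" "word_product G ws = h" by blast
    then show ?case using word_product_append by (intro exI[of _ "us @ ws"]) auto
  qed
qed

lemma len_le: "set ws \<subseteq> letters \<Longrightarrow> len (word_product G ws) \<le> length ws"
  unfolding word_length_def by (rule Least_le) blast

lemma geodesic:
  assumes "g \<in> carrier G"
  obtains ws where "length ws = len g" "set ws \<subseteq> letters" "word_product G ws = g"
proof -
  have "\<exists>n ws. length ws = n \<and> set ws \<subseteq> letters \<and> word_product G ws = g"
    using exists_word[OF assms] by blast
  from LeastI_ex[OF this] show ?thesis
    using that unfolding word_length_def by blast
qed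

text \<open>Membership becomes the existence of a word that need not be shortest, so that words can
  be concatenated, inverted and cut without returning to the \<open>LEAST\<close> in
  \<open>word_length\<close>.\<close>

lemma ball_iff:
  "g \<in> ball n \<longleftrightarrow> (\<exists>ws. length ws \<le> n \<and> set ws \<subseteq> letters \<and> word_product G ws = g)"
proof
  assume "g \<in> ball n"
  then show "\<exists>ws. length ws \<le> n \<and> set ws \<subseteq> letters \<and> word_product G ws = g"
    by (metis (no_types, lifting) cayley_ball_def geodesic mem_Collect_eq)
next
  assume "\<exists>ws. length ws \<le> n \<and> set ws \<subseteq> letters \<and> word_product G ws = g"
  then show "g \<in> ball n"
    using len_le word_product_closed by (fastforce simp: cayley_ball_def)
qed

lemma ball_closed: "g \<in> ball n \<Longrightarrow> g \<in> carrier G"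
  by (simp add: cayley_ball_def)

lemma in_ball_len: "g \<in> carrier G \<Longrightarrow> g \<in> ball (len g)"
  by (simp add: cayley_ball_def)

lemma ball_mono: "m \<le> n \<Longrightarrow> ball m \<subseteq> ball n"
  by (auto simp: cayley_ball_def)

lemma finite_ball [simp]: "finite (ball n)"
proof -
  have "finite letters"
    using finite_generating_set by (simp add: finite_generating_set_def)
  then have "finite (word_product G ` {ws. set ws \<subseteq> letters \<and> length ws \<le> n})"
    by (intro finite_imageI finite_lists_length_le)
  moreover have "ball n \<subseteq> word_product G ` {ws. set ws \<subseteq> letters \<and> length ws \<le> n}"
    by (auto simp: ball_iff)
  ultimately show ?thesis by (rule rev_finite_subset)
qed

lemma one_in_ball [simp]: "\<one> \<in> ball n"
  unfolding ball_iff by (intro exI[of _ "[]"]) simp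

lemma ball_nonempty [simp]: "ball n \<noteq> {}"
  using one_in_ball by blast

lemma ball_0: "ball 0 = {\<one>}"
  by (auto simp: ball_iff)

lemma ball_mult: "u \<in> ball m \<Longrightarrow> v \<in> ball n \<Longrightarrow> u \<otimes> v \<in> ball (m + n)"
  unfolding ball_iff
  by (metis (no_types, lifting) add_mono le_sup_iff length_append set_append word_product_append)

lemma ball_inv: "u \<in> ball n \<Longrightarrow> inv u \<in> ball n"
  unfolding ball_iff by (metis word_product_inverse)

text \<open>A word is cut after \<open>m\<close> letters. This moves a point a prescribed distance
  towards the identity, which the double counting arguments on balls rest on.\<close>

lemma ball_split:
  assumes "g \<in> ball (m + n)"
  obtains u v where "u \<in> ball m" "v \<in> ball n" "g = u \<otimes> v"
proof -
  obtain ws where ws: "length ws \<le> m + n" "set ws \<subseteq> letters" "word_product G ws = g"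
    using assms unfolding ball_iff by blast
  have s: "set (take m ws) \<subseteq> letters" "set (drop m ws) \<subseteq> letters"
    using ws(2) set_take_subset set_drop_subset by (metis subset_trans)+
  show ?thesis
  proof (rule that)
    show "word_product G (take m ws) \<in> ball m"
      unfolding ball_iff by (rule exI[of _ "take m ws"]) (use s in auto)
    show "word_product G (drop m ws) \<in> ball n"
      unfolding ball_iff by (rule exI[of _ "drop m ws"]) (use s ws in auto)
    show "g = word_product G (take m ws) \<otimes> word_product G (drop m ws)"
      using word_product_append[OF s] ws by simp
  qed
qed

lemma card_ball_pos: "card (ball n) > 0"
  by (simp add: card_gt_0_iff)

lemma card_ball_mono: "m \<le> n \<Longrightarrow> card (ball m) \<le> card (ball n)"
  by (simp add: ball_mono card_mono)

section \<open>Finite index measured by the radius of coset representatives\<close>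

text \<open>For a subgroup this is finite index in quantitative form: every right coset has a
  representative in \<open>ball k\<close>. The explicit radius allows statements that are uniform in
  \<open>H\<close>.\<close>

definition syndetic :: "'a set \<Rightarrow> nat \<Rightarrow> bool" where
  "syndetic H k \<longleftrightarrow> (\<forall>g\<in>carrier G. \<exists>t\<in>ball k. g \<otimes> inv t \<in> H)"

definition cosets_in_ball :: "'a set \<Rightarrow> nat \<Rightarrow> 'a set set" where
  "cosets_in_ball H k = (\<lambda>t. H #> t) ` ball k"

lemma syndetic_mono: "syndetic H k \<Longrightarrow> H \<subseteq> H' \<Longrightarrow> k \<le> k' \<Longrightarrow> syndetic H' k'"
  unfolding syndetic_def using ball_mono by blast

text \<open>Any finite set lies in some ball. This serves where representatives come from a choice
  or from a conjugation.\<close>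

lemma syndetic_finite:
  assumes T: "finite T" "T \<subseteq> carrier G"
    and cov: "\<And>g. g \<in> carrier G \<Longrightarrow> \<exists>t\<in>T. g \<otimes> inv t \<in> H"
  shows "\<exists>k. syndetic H k"
proof -
  obtain k where k: "\<And>t. t \<in> T \<Longrightarrow> len t \<le> k"
    using T(1) by (metis finite_imageI finite_nat_set_iff_bounded_le imageI)
  then have "T \<subseteq> ball k"
    using T(2) by (auto simp: cayley_ball_def)
  then have "syndetic H k"
    using cov unfolding syndetic_def by blast
  then show ?thesis ..
qed

lemma rcos_eq_iff:
  assumes "subgroup H G" "g \<in> carrier G" "t \<in> carrier G"
  shows "H #> g = H #> t \<longleftrightarrow> g \<otimes> inv t \<in> H"
proof
  assume "H #> g = H #> t"
  then have "g \<in> H #> t" using rcos_self[OF assms(2,1)] by simp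
  then obtain h where "h \<in> H" "g = h \<otimes> t" by (auto simp: r_coset_def)
  then show "g \<otimes> inv t \<in> H"
    using assms subgroup.mem_carrier[OF assms(1)] by (simp add: m_assoc)
next
  assume h: "g \<otimes> inv t \<in> H"
  then have "g = (g \<otimes> inv t) \<otimes> t" using assms by (simp add: m_assoc)
  then have "g \<in> H #> t" using h by (auto simp: r_coset_def)
  then show "H #> g = H #> t" using repr_independence assms by metis
qed

lemma syndetic_iff_finite_rcosets:
  assumes "subgroup H G"
  shows "(\<exists>k. syndetic H k) \<longleftrightarrow> finite (rcosets H)"
proof
  assume "\<exists>k. syndetic H k"
  then obtain k where k: "syndetic H k" ..
  have "rcosets H \<subseteq> cosets_in_ball H k"
  proof
    fix c assume "c \<in> rcosets H"
    then obtain g where g: "g \<in> carrier G" "c = H #> g"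
      by (auto simp: RCOSETS_def)
    then obtain t where t: "t \<in> ball k" "g \<otimes> inv t \<in> H"
      using k unfolding syndetic_def by blast
    have "H #> g = H #> t"
      using rcos_eq_iff[OF assms g(1)] t ball_closed by blast
    then show "c \<in> cosets_in_ball H k"
      using g t by (auto simp: cosets_in_ball_def)
  qed
  then show "finite (rcosets H)"
    by (rule finite_subset) (simp add: cosets_in_ball_def)
next
  assume fin: "finite (rcosets H)"
  define r where "r c = (SOME t. t \<in> c)" for c :: "'a set"
  have r: "r (H #> g) \<in> H #> g" if "g \<in> carrier G" for g
    unfolding r_def using rcos_self[OF that assms] by (rule someI)
  have sub: "H #> g \<subseteq> carrier G" if "g \<in> carrier G" for g
    using that assms r_coset_subset_G subgroup.subset by blast
  show "\<exists>k. syndetic H k"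
  proof (rule syndetic_finite)
    show "finite (r ` (rcosets H))" using fin by simp
    show "r ` (rcosets H) \<subseteq> carrier G"
      using r sub by (auto simp: RCOSETS_def)
    fix g assume g: "g \<in> carrier G"
    then obtain h where h: "h \<in> H" "r (H #> g) = h \<otimes> g"
      using r[OF g] by (auto simp: r_coset_def)
    have "h \<in> carrier G" using subgroup.mem_carrier[OF assms h(1)] .
    then have "g \<otimes> inv (r (H #> g)) = inv h"
      using h g by (simp add: inv_mult_group)
    then have "g \<otimes> inv (r (H #> g)) \<in> H"
      using h(1) assms subgroup.m_inv_closed by metis
    moreover have "H #> g \<in> rcosets H"
      using g by (auto simp: RCOSETS_def)
    ultimately show "\<exists>t\<in>r ` (rcosets H). g \<otimes> inv t \<in> H"
      by blast
  qed
qed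

section \<open>Cosets met by balls, and density at smaller scales\<close>

lemma rcos_absorb:
  assumes "subgroup H G" "h \<in> H" "t \<in> carrier G"
  shows "H #> (h \<otimes> t) = H #> t"
proof -
  have "h \<in> carrier G" using subgroup.mem_carrier[OF assms(1,2)] .
  then show ?thesis using assms rcos_eq_iff[of H "h \<otimes> t" t] by (simp add: m_assoc)
qed

text \<open>With one representative \<open>r c\<close> in \<open>ball k\<close> for each coset, the
  products \<open>h \<otimes> r c\<close> are distinct: the coset of the product determines
  \<open>c\<close>, and cancellation determines \<open>h\<close>. So meeting m cosets bounds the
  density by 1/m, up to the enlargement of the radius.\<close>

lemma card_inter_times_cosets:
  assumes "subgroup H G"
  shows "card (H \<inter> ball n) * card (cosets_in_ball H k) \<le> card (ball (n + k))"
proof -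
  define r where "r c = (SOME t. t \<in> ball k \<and> H #> t = c)" for c
  have r: "r c \<in> ball k \<and> H #> r c = c" if "c \<in> cosets_in_ball H k" for c
    unfolding r_def by (rule someI_ex) (use that in \<open>auto simp: cosets_in_ball_def\<close>)
  let ?f = "\<lambda>(h, c). h \<otimes> r c"
  have "inj_on ?f ((H \<inter> ball n) \<times> cosets_in_ball H k)"
  proof (rule inj_onI, clarify)
    fix h c h' c'
    assume a: "h \<in> H" "h' \<in> H" "c \<in> cosets_in_ball H k" "c' \<in> cosets_in_ball H k"
      "h \<otimes> r c = h' \<otimes> r c'"
    have cl: "h \<in> carrier G" "h' \<in> carrier G" "r c \<in> carrier G" "r c' \<in> carrier G"
      using subgroup.mem_carrier[OF assms] a(1,2) r[OF a(3)] r[OF a(4)] ball_closed by auto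
    have "H #> (h \<otimes> r c) = H #> r c" "H #> (h' \<otimes> r c') = H #> r c'"
      using a(1,2) cl rcos_absorb[OF assms] by blast+
    then have "c = c'" using a(5) r[OF a(3)] r[OF a(4)] by simp
    then show "h = h' \<and> c = c'" using a(5) cl by simp
  qed
  then have "card ((H \<inter> ball n) \<times> cosets_in_ball H k)
      = card (?f ` ((H \<inter> ball n) \<times> cosets_in_ball H k))"
    by (simp add: card_image)
  also have "\<dots> \<le> card (ball (n + k))"
    using r ball_mult by (intro card_mono) auto
  finally show ?thesis by (simp add: card_cartesian_product)
qed

text \<open>Right multiplication by an element of \<open>ball 1\<close> sends cosets met by
  \<open>ball k\<close> to cosets met by \<open>ball k\<close>, so by induction on word length no
  new coset can ever appear.\<close>

lemma cosets_in_ball_stable: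
  assumes H: "subgroup H G" and eq: "cosets_in_ball H (Suc k) = cosets_in_ball H k"
  shows "syndetic H k"
  unfolding syndetic_def
proof
  fix g assume "g \<in> carrier G"
  then have "g \<in> ball (len g)" by (rule in_ball_len)
  moreover have "\<exists>t\<in>ball k. g \<otimes> inv t \<in> H" if "g \<in> ball n" for g n
    using that
  proof (induction n arbitrary: g)
    case 0
    then show ?case
      using H by (intro bexI[of _ "\<one>"]) (auto simp: ball_0 subgroup.one_closed)
  next
    case (Suc n)
    then obtain u v where uv: "u \<in> ball n" "v \<in> ball 1" "g = u \<otimes> v"
      using ball_split[of g n 1] by auto
    obtain t where t: "t \<in> ball k" "u \<otimes> inv t \<in> H" using Suc.IH uv by blast
    have cl: "u \<in> carrier G" "v \<in> carrier G" "t \<in> carrier G"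
      using uv t ball_closed by blast+
    have "t \<otimes> v \<in> ball (Suc k)" using ball_mult[OF t(1) uv(2)] by simp
    then have "H #> (t \<otimes> v) \<in> cosets_in_ball H k"
      using eq by (auto simp: cosets_in_ball_def)
    then obtain s where s: "s \<in> ball k" "H #> (t \<otimes> v) = H #> s"
      by (auto simp: cosets_in_ball_def)
    then have "(t \<otimes> v) \<otimes> inv s \<in> H"
      using rcos_eq_iff[OF H] cl ball_closed by blast
    from subgroup.m_closed[OF H t(2) this]
    have "(u \<otimes> inv t) \<otimes> ((t \<otimes> v) \<otimes> inv s) \<in> H" .
    also have "(u \<otimes> inv t) \<otimes> ((t \<otimes> v) \<otimes> inv s) = g \<otimes> inv s"
      using cl uv(3) ball_closed[OF s(1)] by (simp add: m_assoc)
    finally show ?case using s by blast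
  qed
  ultimately show "\<exists>t\<in>ball k. g \<otimes> inv t \<in> H" by blast
qed

text \<open>Radius 0 meets one coset, and each of the \<open>k + 1\<close> enlargements up to
  \<open>Suc k\<close> adds at least one more, since otherwise the process would have
  stabilised.\<close>

lemma card_cosets_in_ball:
  assumes "subgroup H G" "\<not> syndetic H k"
  shows "k + 2 \<le> card (cosets_in_ball H (Suc k))"
  using assms(2)
proof (induction k)
  have *: "card (cosets_in_ball H k) < card (cosets_in_ball H (Suc k))"
    if "\<not> syndetic H k" for k
  proof -
    have "cosets_in_ball H k \<subseteq> cosets_in_ball H (Suc k)"
      using ball_mono[of k "Suc k"] by (auto simp: cosets_in_ball_def)
    then have "cosets_in_ball H k \<subset> cosets_in_ball H (Suc k)"
      using cosets_in_ball_stable[OF assms(1)] that by blast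
    then show ?thesis by (intro psubset_card_mono) (auto simp: cosets_in_ball_def)
  qed
  {
    case 0
    then show ?case using *[of 0] by (simp add: cosets_in_ball_def ball_0)
  next
    case (Suc k)
    then have "\<not> syndetic H k" using syndetic_mono[of H k H "Suc k"] by auto
    then show ?case using Suc *[of "Suc k"] by simp
  }
qed

text \<open>Double counting: moving a point of \<open>H\<close> a distance \<open>r\<close> towards the identity places
  a whole translate of the \<open>r\<close>-ball inside the \<open>n\<close>-ball, so some point of the \<open>n\<close>-ball has many
  points of \<open>H\<close> within distance \<open>2r\<close>. This carries density of \<open>H\<close> from a single large scale down
  to every smaller scale.\<close>
lemma dense_subgroup_smaller_ball:
  assumes H: "subgroup H G" and rn: "r \<le> n"
    and dense: "a * real (card (ball n)) \<le> real (card (H \<inter> ball n))"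
  shows "a * real (card (ball r)) \<le> real (card (H \<inter> ball (4 * r)))"
proof -
  define near where "near x = {h \<in> H \<inter> ball n. inv x \<otimes> h \<in> ball (2 * r)}" for x
  have fin: "finite (H \<inter> ball n)" by simp
  have "card (ball r) * card (H \<inter> ball n) \<le> (\<Sum>h\<in>H \<inter> ball n. card {x \<in> ball n. inv x \<otimes> h \<in> ball (2 * r)})"
  proof -
    have "card (ball r) \<le> card {x \<in> ball n. inv x \<otimes> h \<in> ball (2 * r)}"
      if h: "h \<in> H \<inter> ball n" for h
    proof -
      have "h \<in> ball ((n - r) + r)" using h rn by simp
      then obtain y v where yv: "y \<in> ball (n - r)" "v \<in> ball r" "h = y \<otimes> v"
        by (rule ball_split)
      have cl: "y \<in> carrier G" "v \<in> carrier G" using yv ball_closed by auto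
      have "inj_on ((\<otimes>) y) (ball r)"
        using inj_on_subset[OF inj_on_cmult[OF cl(1)]] ball_closed by blast
      then have "card (ball r) = card ((\<otimes>) y ` ball r)" by (simp add: card_image)
      also have "\<dots> \<le> card {x \<in> ball n. inv x \<otimes> h \<in> ball (2 * r)}"
      proof (intro card_mono)
        show "(\<otimes>) y ` ball r \<subseteq> {x \<in> ball n. inv x \<otimes> h \<in> ball (2 * r)}"
        proof clarify
          fix b assume b: "b \<in> ball r"
          have "y \<otimes> b \<in> ball n" using ball_mult[OF yv(1) b] rn by simp
          moreover have "inv (y \<otimes> b) \<otimes> h = inv b \<otimes> v"
            using cl ball_closed[OF b] yv(3) by (simp add: inv_mult_group m_assoc)
          moreover have "inv b \<otimes> v \<in> ball (2 * r)"
            using ball_mult[OF ball_inv[OF b] yv(2)] by (simp add: mult_2)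
          ultimately show "y \<otimes> b \<in> ball n \<and> inv (y \<otimes> b) \<otimes> h \<in> ball (2 * r)" by simp
        qed
      qed simp
      finally show ?thesis .
    qed
    then have "(\<Sum>h\<in>H \<inter> ball n. card (ball r))
        \<le> (\<Sum>h\<in>H \<inter> ball n. card {x \<in> ball n. inv x \<otimes> h \<in> ball (2 * r)})"
      by (rule sum_mono)
    then show ?thesis by (simp add: mult.commute)
  qed
  also have "\<dots> = (\<Sum>x\<in>ball n. card (near x))"
    unfolding near_def by (rule sum_multicount_gen) (auto simp: fin)
  finally have count: "card (ball r) * card (H \<inter> ball n) \<le> (\<Sum>x\<in>ball n. card (near x))" .
  have "\<exists>x\<in>ball n. a * real (card (ball r)) \<le> real (card (near x))"
  proof (rule ccontr)
    assume "\<not> ?thesis"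
    then have "(\<Sum>x\<in>ball n. real (card (near x))) < (\<Sum>x\<in>ball n. a * real (card (ball r)))"
      by (intro sum_strict_mono) (auto simp: not_le)
    also have "\<dots> = real (card (ball r)) * (a * real (card (ball n)))" by simp
    also have "\<dots> \<le> real (card (ball r)) * real (card (H \<inter> ball n))"
      using dense by (intro mult_left_mono) auto
    also have "\<dots> \<le> (\<Sum>x\<in>ball n. real (card (near x)))"
      using count by (metis of_nat_le_iff of_nat_mult of_nat_sum)
    finally show False by simp
  qed
  then obtain x where x: "x \<in> ball n" "a * real (card (ball r)) \<le> real (card (near x))" ..
  show ?thesis
  proof (cases "near x = {}")
    \<comment> \<open>An empty \<open>near x\<close> offers no base point to translate by, but then
      \<open>x(2)\<close> makes the left side at most zero.\<close>
    case True
    then show ?thesis using x(2) by (simp add: order_trans[OF _ of_nat_0_le_iff])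
  next
    case False
    then obtain h0 where h0: "h0 \<in> near x" by blast
    have clH: "h \<in> carrier G" if "h \<in> near x" for h
      using that ball_closed by (auto simp: near_def)
    have xc: "x \<in> carrier G" using x ball_closed by blast
    \<comment> \<open>Translation by \<open>inv h0\<close> with \<open>h0\<close> in
      \<open>H\<close> moves the cluster around \<open>x\<close> to the identity without leaving
      \<open>H\<close>. Two points within \<open>2 * r\<close> of \<open>x\<close> are within
      \<open>4 * r\<close> of each other.\<close>
    have "inj_on ((\<otimes>) (inv h0)) (near x)"
      using inj_on_subset[OF inj_on_cmult[OF inv_closed[OF clH[OF h0]]]] clH by blast
    then have "card (near x) = card ((\<otimes>) (inv h0) ` near x)" by (simp add: card_image)
    also have "\<dots> \<le> card (H \<inter> ball (4 * r))"
    proof (intro card_mono)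
      show "(\<otimes>) (inv h0) ` near x \<subseteq> H \<inter> ball (4 * r)"
      proof clarify
        fix h assume h: "h \<in> near x"
        have "inv h0 \<otimes> h \<in> H"
          using h h0 subgroup.m_closed[OF H subgroup.m_inv_closed[OF H]] by (auto simp: near_def)
        moreover have "inv (inv x \<otimes> h0) \<otimes> (inv x \<otimes> h) \<in> ball (2 * r + 2 * r)"
          using h h0 by (intro ball_mult ball_inv) (auto simp: near_def)
        moreover have "inv (inv x \<otimes> h0) \<otimes> (inv x \<otimes> h) = inv h0 \<otimes> h"
          using clH[OF h] clH[OF h0] xc by (simp add: inv_mult_group m_assoc)
        ultimately show "inv h0 \<otimes> h \<in> H \<inter> ball (4 * r)" by simp
      qed
    qed simp
    finally show ?thesis using x(2) by linarith
  qed
qed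

section \<open>Doubling scales, and bounded index from density\<close>

text \<open>Only unboundedly many scales are asked for, which is what a polynomial upper bound
  yields directly. The factor 6 is 4 + 2: density is recovered in \<open>ball (4 * r)\<close> and
  cosets are counted in \<open>ball (2 * r)\<close>.\<close>

definition doubling_scales :: "real \<Rightarrow> bool" where
  "doubling_scales K \<longleftrightarrow> (\<forall>R. \<exists>r\<ge>R. real (card (ball (6 * r))) \<le> K * real (card (ball r)))"

lemma doubling_scales_pos: "doubling_scales K \<Longrightarrow> K > 0"
proof -
  assume "doubling_scales K"
  then obtain r where "real (card (ball (6 * r))) \<le> K * real (card (ball r))"
    unfolding doubling_scales_def by blast
  moreover have "real (card (ball (6 * r))) > 0" using card_ball_pos by simp
  ultimately have "K * real (card (ball r)) > 0" by linarith
  then show "K > 0" by (simp add: zero_less_mult_iff)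
qed

text \<open>If every sixfold enlargement from some scale on multiplied the ball by more than
  \<open>6 ^ Suc e\<close>, iteration would beat a polynomial bound of degree \<open>e\<close>. That
  bound is given for another generating set \<open>Y\<close>, so balls for \<open>X\<close> are
  first placed inside balls for \<open>Y\<close> of proportional radius.\<close>

lemma polynomial_growth_imp_doubling_scales:
  assumes "polynomial_growth G"
  obtains K where "doubling_scales K"
proof -
  obtain Y D d where Y: "finite_generating_set G Y"
    and growth: "\<forall>\<^sub>F n in sequentially. real (card (cayley_ball G Y n)) \<le> D * real n powr d"
    using assms unfolding polynomial_growth_def by blast
  interpret Y: fg_group G Y by unfold_locales (rule Y)
  have "finite (Y.len ` letters)"
    using finite_generating_set by (simp add: finite_generating_set_def)
  then obtain m where m: "\<And>x. x \<in> letters \<Longrightarrow> Y.len x \<le> m"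
    by (metis finite_nat_set_iff_bounded_le imageI)
  \<comment> \<open>The successor makes \<open>c\<close> positive, so that \<open>c * n\<close> is
    at least \<open>n\<close>.\<close>
  define c where "c = Suc m"
  have c: "c > 0" "\<And>x. x \<in> letters \<Longrightarrow> x \<in> Y.ball c"
    using m letters_closed unfolding c_def cayley_ball_def by (auto intro: le_SucI)
  have word: "word_product G ws \<in> Y.ball (length ws * c)" if "set ws \<subseteq> letters" for ws
    using that by (induction ws) (auto intro!: Y.ball_mult c)
  have sub: "ball n \<subseteq> Y.ball (c * n)" for n
  proof
    fix g assume "g \<in> ball n"
    then obtain ws where ws: "length ws \<le> n" "set ws \<subseteq> letters" "word_product G ws = g"
      unfolding ball_iff by blast
    have "length ws * c \<le> c * n" using ws(1) by simp
    then show "g \<in> Y.ball (c * n)" using word[OF ws(2)] ws(3) Y.ball_mono by blast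
  qed
  have le: "card (ball n) \<le> card (Y.ball (c * n))" for n
    using sub by (simp add: card_mono)
  obtain N where N: "\<And>n. n \<ge> N \<Longrightarrow> real (card (Y.ball n)) \<le> D * real n powr d"
    using growth unfolding eventually_sequentially by blast
  define e where "e = nat \<lceil>\<bar>d\<bar>\<rceil>"
  have "d \<le> real e" unfolding e_def by linarith
  have bound: "real (card (ball n)) \<le> \<bar>D\<bar> * (real c * real n) ^ e" if "n \<ge> Suc N" for n
  proof -
    have "c * n \<ge> N" using that c(1) by (metis Suc_leD le_trans mult_le_mono1 nat_mult_1 Suc_leI One_nat_def)
    have "1 \<le> c * n" using that c(1) by (simp add: Suc_le_eq)
    then have cn: "1 \<le> real (c * n)" by (metis of_nat_1 of_nat_le_iff)
    have "real (card (ball n)) \<le> D * real (c * n) powr d"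
      using N[OF \<open>c * n \<ge> N\<close>] le[of n] by linarith
    also have "\<dots> \<le> \<bar>D\<bar> * real (c * n) powr real e"
      using cn \<open>d \<le> real e\<close> by (intro mult_mono powr_mono) auto
    also have "\<dots> = \<bar>D\<bar> * (real c * real n) ^ e"
      using cn by (simp add: powr_realpow)
    finally show ?thesis .
  qed
  have "doubling_scales (6 ^ Suc e)"
    unfolding doubling_scales_def
  proof (rule ccontr)
    assume "\<not> (\<forall>R. \<exists>r\<ge>R. real (card (ball (6 * r))) \<le> 6 ^ Suc e * real (card (ball r)))"
    then obtain R0 where R0: "\<And>r. r \<ge> R0 \<Longrightarrow> real (card (ball (6 * r))) > 6 ^ Suc e * real (card (ball r))"
      by (meson not_le)
    define R where "R = max R0 (Suc N)"
    have R: "R \<ge> R0" "R \<ge> Suc N" unfolding R_def by auto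
    have lower: "real (card (ball (6 ^ j * R))) \<ge> (6 ^ Suc e) ^ j" for j
    proof (induction j)
      case 0
      then show ?case using card_ball_pos[of R] by simp
    next
      case (Suc j)
      have "6 ^ j * R \<ge> R0" using R(1) by (metis le_trans mult_le_mono1 nat_mult_1 one_le_numeral one_le_power)
      have "(6 ^ Suc e) ^ Suc j = 6 ^ Suc e * (6 ^ Suc e) ^ j" by (rule power_Suc)
      also have "\<dots> \<le> 6 ^ Suc e * real (card (ball (6 ^ j * R)))"
        using Suc by (intro mult_left_mono) auto
      also have "\<dots> < real (card (ball (6 * (6 ^ j * R))))"
        using R0[OF \<open>6 ^ j * R \<ge> R0\<close>] .
      finally show ?case by (simp add: mult.assoc)
    qed
    define M where "M = \<bar>D\<bar> * (real c * real R) ^ e"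
    have "(6::real) ^ j \<le> M" for j
    proof -
      have "6 ^ j * R \<ge> Suc N" using R(2) by (metis le_trans mult_le_mono1 nat_mult_1 one_le_numeral one_le_power)
      have "(6 ^ j) * (6 ^ e) ^ j = ((6::real) ^ Suc e) ^ j" by (simp add: power_mult_distrib)
      also have "\<dots> \<le> \<bar>D\<bar> * (real c * real (6 ^ j * R)) ^ e"
        using lower[of j] bound[OF \<open>6 ^ j * R \<ge> Suc N\<close>] by linarith
      also have "\<dots> = M * (6 ^ e) ^ j"
        by (simp add: M_def power_mult_distrib power_mult[symmetric] mult.commute)
      finally show ?thesis by simp
    qed
    moreover obtain j where "M < 6 ^ j" using real_arch_pow[of 6 M] by auto
    ultimately show False by (meson not_le)
  qed
  then show ?thesis using that by blast
qed

text \<open>At a doubling scale \<open>r\<close>, density \<open>a\<close> allows at most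
  \<open>K / a\<close> cosets to be met by \<open>ball (2 * r)\<close>, whereas a subgroup that is
  not syndetic at \<open>2 * r\<close> meets at least \<open>r\<close> of them. It is essential that
  \<open>k\<close> and \<open>N\<close> are chosen before \<open>H\<close>: the result is applied to
  varying centralizers.\<close>

lemma dense_imp_syndetic:
  assumes K: "doubling_scales K" and a: "a > 0"
  shows "\<exists>k N. \<forall>H n. subgroup H G \<longrightarrow> n \<ge> N \<longrightarrow>
    a * real (card (ball n)) \<le> real (card (H \<inter> ball n)) \<longrightarrow> syndetic H k"
proof -
  obtain r where r: "r \<ge> Suc (nat \<lceil>K / a\<rceil>)" "real (card (ball (6 * r))) \<le> K * real (card (ball r))"
    using K unfolding doubling_scales_def by blast
  have "K / a < real r" using r(1) by linarith
  then have Kr: "K < a * real r" using a by (simp add: field_simps)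
  show ?thesis
  proof (intro exI allI impI)
    fix H n assume H: "subgroup H G" "n \<ge> r" "a * real (card (ball n)) \<le> real (card (H \<inter> ball n))"
    show "syndetic H (2 * r)"
    proof (rule ccontr)
      assume n: "\<not> syndetic H (2 * r)"
      \<comment> \<open>The count at \<open>2 * r - 1\<close> gives \<open>2 * r + 1\<close> cosets
        met by \<open>ball (2 * r)\<close>; \<open>r\<close> of them are enough.\<close>
      have "\<not> syndetic H (2 * r - 1)" using n syndetic_mono[of H "2 * r - 1" H "2 * r"] by auto
      from card_cosets_in_ball[OF H(1) this] have "r \<le> card (cosets_in_ball H (2 * r))"
        using r(1) by simp
      then have "a * real (card (ball r)) * real r
          \<le> real (card (H \<inter> ball (4 * r))) * real (card (cosets_in_ball H (2 * r)))"
        using dense_subgroup_smaller_ball[OF H] a by (intro mult_mono) auto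
      also have "\<dots> \<le> real (card (ball (6 * r)))"
        using card_inter_times_cosets[OF H(1), of "4 * r" "2 * r"]
        by (simp only: of_nat_mult[symmetric] of_nat_le_iff distrib_right[symmetric]) simp
      also have "\<dots> \<le> K * real (card (ball r))" by (rule r(2))
      finally have "(a * real r) * real (card (ball r)) \<le> K * real (card (ball r))"
        by (simp add: mult_ac)
      moreover have "real (card (ball r)) > 0" using card_ball_pos by simp
      ultimately show False using Kr by (simp add: mult_le_cancel_right)
    qed
  qed
qed

section \<open>Centralizers and the FC-centre\<close>

definition centralizer :: "'a \<Rightarrow> 'a set" where
  "centralizer u = {g \<in> carrier G. g \<otimes> u = u \<otimes> g}"

lemma commute_inv:
  assumes "g \<in> carrier G" "u \<in> carrier G" "g \<otimes> u = u \<otimes> g"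
  shows "inv g \<otimes> u = u \<otimes> inv g"
proof -
  have "inv g \<otimes> u = inv g \<otimes> (u \<otimes> (g \<otimes> inv g))" using assms(1,2) by simp
  also have "\<dots> = inv g \<otimes> ((g \<otimes> u) \<otimes> inv g)"
    using assms by (simp only: m_assoc m_closed inv_closed)
  also have "\<dots> = u \<otimes> inv g" using assms(1,2) by (simp add: m_assoc)
  finally show ?thesis .
qed

lemma commute_mult:
  assumes "g \<in> carrier G" "h \<in> carrier G" "u \<in> carrier G" "g \<otimes> u = u \<otimes> g" "h \<otimes> u = u \<otimes> h"
  shows "(g \<otimes> h) \<otimes> u = u \<otimes> (g \<otimes> h)"
  using assms by (metis m_assoc)

lemma subgroup_centralizer:
  assumes "u \<in> carrier G"
  shows "subgroup (centralizer u) G"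
  using assms commute_inv commute_mult
  by (intro subgroupI) (auto simp: centralizer_def intro!: exI[of _ "\<one>"])

text \<open>A nonempty intersection of a coset of \<open>H\<close> with a coset of \<open>H'\<close>
  is a coset of \<open>H \<inter> H'\<close>, so one point from each such intersection gives
  finitely many representatives.\<close>

lemma syndetic_Int:
  assumes H: "subgroup H G" "syndetic H k" and H': "subgroup H' G" "syndetic H' k'"
  shows "\<exists>l. syndetic (H \<inter> H') l"
proof -
  let ?P = "\<lambda>s t g. g \<in> carrier G \<and> g \<otimes> inv s \<in> H \<and> g \<otimes> inv t \<in> H'"
  \<comment> \<open>Pairs of disjoint cosets get the default \<open>\<one>\<close>, which keeps all
    values in the carrier.\<close>
  define r where "r = (\<lambda>(s, t). if \<exists>g. ?P s t g then SOME g. ?P s t g else \<one>)"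
  have r: "?P s t (r (s, t))" if "?P s t g" for s t g
    using someI[of "?P s t" g, OF that] that unfolding r_def by auto
  show ?thesis
  proof (rule syndetic_finite)
    show "finite (r ` (ball k \<times> ball k'))" by simp
    have "r (s, t) \<in> carrier G" for s t
    proof (cases "\<exists>g. ?P s t g")
      case True
      then show ?thesis using r by blast
    next
      case False
      then have "r (s, t) = \<one>" unfolding r_def by (simp only: prod.case if_False)
      then show ?thesis by simp
    qed
    then show "r ` (ball k \<times> ball k') \<subseteq> carrier G" by auto
    fix g assume g: "g \<in> carrier G"
    obtain s where s: "s \<in> ball k" "g \<otimes> inv s \<in> H" using H(2) g unfolding syndetic_def by blast
    obtain t where t: "t \<in> ball k'" "g \<otimes> inv t \<in> H'" using H'(2) g unfolding syndetic_def by blast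
    let ?x = "r (s, t)"
    have x: "?P s t ?x" using r g s t by blast
    have cl: "s \<in> carrier G" "t \<in> carrier G" using s t ball_closed by auto
    have "(g \<otimes> inv s) \<otimes> inv (?x \<otimes> inv s) = g \<otimes> inv ?x"
      "(g \<otimes> inv t) \<otimes> inv (?x \<otimes> inv t) = g \<otimes> inv ?x"
      using g x cl by (simp_all add: inv_mult_group m_assoc)
    moreover have "(g \<otimes> inv s) \<otimes> inv (?x \<otimes> inv s) \<in> H"
      using subgroup.m_closed[OF H(1) s(2) subgroup.m_inv_closed[OF H(1)]] x by blast
    moreover have "(g \<otimes> inv t) \<otimes> inv (?x \<otimes> inv t) \<in> H'"
      using subgroup.m_closed[OF H'(1) t(2) subgroup.m_inv_closed[OF H'(1)]] x by blast
    ultimately have "g \<otimes> inv ?x \<in> H \<inter> H'" by simp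
    then show "\<exists>x\<in>r ` (ball k \<times> ball k'). g \<otimes> inv x \<in> H \<inter> H'"
      using s t by blast
  qed
qed

lemma syndetic_Inter_centralizers:
  assumes "finite Y" "subgroup F G" "syndetic F k" "Y \<subseteq> carrier G"
    and "\<And>y. y \<in> Y \<Longrightarrow> \<exists>l. syndetic (centralizer y) l"
  shows "subgroup (F \<inter> (\<Inter>y\<in>Y. centralizer y)) G \<and> (\<exists>l. syndetic (F \<inter> (\<Inter>y\<in>Y. centralizer y)) l)"
  using assms(1,4,5)
proof (induction Y)
  case empty
  then show ?case using assms by auto
next
  case (insert y Y)
  let ?I = "F \<inter> (\<Inter>y\<in>Y. centralizer y)"
  have IH: "subgroup ?I G" "\<exists>l. syndetic ?I l" using insert by auto
  have y: "subgroup (centralizer y) G" "\<exists>l. syndetic (centralizer y) l"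
    using insert.prems subgroup_centralizer by auto
  have "F \<inter> (\<Inter>y\<in>insert y Y. centralizer y) = ?I \<inter> centralizer y" by auto
  then show ?case
    using subgroups_Inter_pair[OF IH(1) y(1)] syndetic_Int[OF IH(1) _ y(1)] IH(2) y(2) by auto
qed

definition fc_centre :: "'a set" where
  "fc_centre = {u \<in> carrier G. \<exists>k. syndetic (centralizer u) k}"

lemma subgroup_fc_centre: "subgroup fc_centre G"
proof (rule subgroupI)
  show "fc_centre \<subseteq> carrier G" by (auto simp: fc_centre_def)
  have "centralizer \<one> = carrier G" by (auto simp: centralizer_def)
  then have "syndetic (centralizer \<one>) 0" by (auto simp: syndetic_def ball_0)
  then show "fc_centre \<noteq> {}" by (auto simp: fc_centre_def)
next
  fix u assume u: "u \<in> fc_centre"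
  then obtain k where uk: "u \<in> carrier G" "syndetic (centralizer u) k"
    by (auto simp: fc_centre_def)
  have "centralizer u \<subseteq> centralizer (inv u)"
  proof
    fix g assume "g \<in> centralizer u"
    then have g: "g \<in> carrier G" "g \<otimes> u = u \<otimes> g" by (auto simp: centralizer_def)
    then show "g \<in> centralizer (inv u)"
      using commute_inv[OF uk(1) g(1)] by (simp add: centralizer_def)
  qed
  from syndetic_mono[OF uk(2) this order_refl] show "inv u \<in> fc_centre"
    using uk(1) by (auto simp: fc_centre_def)
next
  fix u v assume u: "u \<in> fc_centre" and v: "v \<in> fc_centre"
  have cl: "u \<in> carrier G" "v \<in> carrier G" using u v by (auto simp: fc_centre_def)
  have "centralizer u \<inter> centralizer v \<subseteq> centralizer (u \<otimes> v)"
  proof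
    fix g assume "g \<in> centralizer u \<inter> centralizer v"
    then have g: "g \<in> carrier G" "u \<otimes> g = g \<otimes> u" "v \<otimes> g = g \<otimes> v" by (auto simp: centralizer_def)
    then show "g \<in> centralizer (u \<otimes> v)"
      using commute_mult[OF cl g(1)] by (simp add: centralizer_def)
  qed
  moreover obtain k k' where "syndetic (centralizer u) k" "syndetic (centralizer v) k'"
    using u v by (auto simp: fc_centre_def)
  then obtain l where "syndetic (centralizer u \<inter> centralizer v) l"
    using syndetic_Int[OF subgroup_centralizer[OF cl(1)] _ subgroup_centralizer[OF cl(2)]] by blast
  ultimately have "syndetic (centralizer (u \<otimes> v)) l"
    using syndetic_mono by blast
  then show "u \<otimes> v \<in> fc_centre" using cl by (auto simp: fc_centre_def)
qed

text \<open>Conjugation by \<open>x\<close> carries the centralizer of \<open>u\<close> to that of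
  the conjugate, and carries coset representatives along with it.\<close>

lemma fc_centre_conj:
  assumes u: "u \<in> fc_centre" and x: "x \<in> carrier G"
  shows "x \<otimes> u \<otimes> inv x \<in> fc_centre"
proof -
  have uc: "u \<in> carrier G" using u by (auto simp: fc_centre_def)
  obtain k where k: "syndetic (centralizer u) k" using u by (auto simp: fc_centre_def)
  have "\<exists>l. syndetic (centralizer (x \<otimes> u \<otimes> inv x)) l"
  proof (rule syndetic_finite)
    show "finite ((\<lambda>t. x \<otimes> t \<otimes> inv x) ` ball k)" by simp
    show "(\<lambda>t. x \<otimes> t \<otimes> inv x) ` ball k \<subseteq> carrier G" using x ball_closed by auto
    fix g assume g: "g \<in> carrier G"
    then have "inv x \<otimes> g \<otimes> x \<in> carrier G" using x by simp
    then obtain t where t: "t \<in> ball k" "(inv x \<otimes> g \<otimes> x) \<otimes> inv t \<in> centralizer u"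
      using k unfolding syndetic_def by blast
    let ?c = "(inv x \<otimes> g \<otimes> x) \<otimes> inv t"
    have tc: "t \<in> carrier G" using t ball_closed by blast
    have "g \<otimes> inv (x \<otimes> t \<otimes> inv x) = x \<otimes> ?c \<otimes> inv x"
      using g x tc by (simp add: inv_mult_group m_assoc)
    moreover have "x \<otimes> ?c \<otimes> inv x \<in> centralizer (x \<otimes> u \<otimes> inv x)"
    proof -
      have c: "?c \<in> carrier G" "?c \<otimes> u = u \<otimes> ?c" using t(2) by (auto simp: centralizer_def)
      have "(x \<otimes> c \<otimes> inv x) \<otimes> (x \<otimes> u \<otimes> inv x) = x \<otimes> (c \<otimes> u) \<otimes> inv x"
        "(x \<otimes> u \<otimes> inv x) \<otimes> (x \<otimes> c \<otimes> inv x) = x \<otimes> (u \<otimes> c) \<otimes> inv x"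
        if "c \<in> carrier G" for c
        using that x uc by (simp_all add: m_assoc)
      then show ?thesis using c x by (simp add: centralizer_def)
    qed
    ultimately have "g \<otimes> inv (x \<otimes> t \<otimes> inv x) \<in> centralizer (x \<otimes> u \<otimes> inv x)" by metis
    then show "\<exists>t\<in>(\<lambda>t. x \<otimes> t \<otimes> inv x) ` ball k. g \<otimes> inv t \<in> centralizer (x \<otimes> u \<otimes> inv x)"
      using t(1) by blast
  qed
  then show ?thesis using uc x by (auto simp: fc_centre_def)
qed

section \<open>The centre of the FC-centre as an abelian normal subgroup\<close>

text \<open>This is the centre of the group \<open>fc_centre\<close>: abelian by construction, and
  normal in \<open>G\<close> as the centre of a normal subgroup.\<close>

definition fc_kernel :: "'a set" where
  "fc_kernel = {z \<in> fc_centre. \<forall>u\<in>fc_centre. z \<otimes> u = u \<otimes> z}"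

lemma fc_kernel_closed: "z \<in> fc_kernel \<Longrightarrow> z \<in> carrier G"
  by (auto simp: fc_kernel_def fc_centre_def)

lemma fc_kernel_comm: "x \<in> fc_kernel \<Longrightarrow> y \<in> fc_kernel \<Longrightarrow> x \<otimes> y = y \<otimes> x"
  unfolding fc_kernel_def by blast

lemma normal_fc_kernel: "fc_kernel \<lhd> G"
proof -
  have cl: "u \<in> carrier G" if "u \<in> fc_centre" for u using that by (auto simp: fc_centre_def)
  note sub = subgroup_fc_centre
  have "subgroup fc_kernel G"
  proof (rule subgroupI)
    show "fc_kernel \<subseteq> carrier G" using fc_kernel_closed by blast
    show "fc_kernel \<noteq> {}"
      using subgroup.one_closed[OF sub] cl by (auto simp: fc_kernel_def)
    show "inv z \<in> fc_kernel" if z: "z \<in> fc_kernel" for z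
    proof -
      have "inv z \<otimes> u = u \<otimes> inv z" if "u \<in> fc_centre" for u
        using commute_inv[OF fc_kernel_closed[OF z] cl[OF that]] z that by (simp add: fc_kernel_def)
      then show ?thesis using z subgroup.m_inv_closed[OF sub] by (simp add: fc_kernel_def)
    qed
    show "z \<otimes> z' \<in> fc_kernel" if z: "z \<in> fc_kernel" "z' \<in> fc_kernel" for z z'
    proof -
      have "z \<otimes> z' \<otimes> u = u \<otimes> (z \<otimes> z')" if "u \<in> fc_centre" for u
      proof (rule commute_mult)
        show "z \<in> carrier G" "z' \<in> carrier G" "u \<in> carrier G"
          using fc_kernel_closed z cl that by blast+
        show "z \<otimes> u = u \<otimes> z" "z' \<otimes> u = u \<otimes> z'"
          using z that unfolding fc_kernel_def by blast+
      qed
      moreover have "z \<otimes> z' \<in> fc_centre"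
        using z by (intro subgroup.m_closed[OF sub]) (simp_all add: fc_kernel_def)
      ultimately show ?thesis unfolding fc_kernel_def by blast
    qed
  qed
  moreover have "x \<otimes> z \<otimes> inv x \<in> fc_kernel" if x: "x \<in> carrier G" and z: "z \<in> fc_kernel" for x z
  proof -
    have zF: "z \<in> fc_centre" using z by (simp add: fc_kernel_def)
    have "(x \<otimes> z \<otimes> inv x) \<otimes> u = u \<otimes> (x \<otimes> z \<otimes> inv x)" if u: "u \<in> fc_centre" for u
    proof -
      have "inv x \<otimes> u \<otimes> x \<in> fc_centre" using fc_centre_conj[OF u inv_closed[OF x]] x by simp
      then have "z \<otimes> (inv x \<otimes> u \<otimes> x) = (inv x \<otimes> u \<otimes> x) \<otimes> z"
        using z unfolding fc_kernel_def by blast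
      then have "x \<otimes> (z \<otimes> (inv x \<otimes> u \<otimes> x)) \<otimes> inv x = x \<otimes> ((inv x \<otimes> u \<otimes> x) \<otimes> z) \<otimes> inv x"
        by simp
      then show ?thesis using x cl[OF u] cl[OF zF] by (simp add: m_assoc)
    qed
    then show ?thesis using fc_centre_conj[OF zF x] unfolding fc_kernel_def by blast
  qed
  ultimately show ?thesis by (simp add: normal_inv_iff)
qed

text \<open>By Schreier's argument an element of \<open>fc_centre\<close> commuting with the finite set \<open>Y\<close>, a
  generating set of \<open>fc_centre\<close>, is central there, so \<open>fc_kernel\<close> is cut out by finitely many
  centralizers.\<close>
lemma syndetic_fc_kernel:
  assumes "syndetic fc_centre k"
  shows "\<exists>l. syndetic fc_kernel l"
proof -
  note sub = subgroup_fc_centre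
  \<comment> \<open>The radius is \<open>k + 1 + k\<close>: a Schreier generator is a
    representative, an element of \<open>ball 1\<close> and an inverse representative.\<close>
  define Y where "Y = fc_centre \<inter> ball (2 * k + 1)"
  let ?I = "fc_centre \<inter> (\<Inter>y\<in>Y. centralizer y)"
  have Y: "finite Y" "Y \<subseteq> carrier G" "\<And>y. y \<in> Y \<Longrightarrow> \<exists>l. syndetic (centralizer y) l"
    unfolding Y_def fc_centre_def by auto
  have "\<exists>l. syndetic ?I l"
    using syndetic_Inter_centralizers[OF Y(1) sub assms Y(2)] Y(3) by blast
  moreover have "?I \<subseteq> fc_kernel"
  proof
    fix z assume z: "z \<in> ?I"
    have zc: "z \<in> carrier G" using z by (auto simp: fc_centre_def)
    have zY: "y \<in> centralizer z" if "y \<in> Y" for y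
    proof -
      have "y \<in> carrier G" "z \<in> centralizer y" using z that by (auto simp: Y_def fc_centre_def)
      then show ?thesis by (simp add: centralizer_def)
    qed
    note Cz = subgroup_centralizer[OF zc]
    \<comment> \<open>Schreier rewriting: reading \<open>g\<close> letter by letter, the part in
      front of the current representative gains one element of \<open>Y\<close> at each step, so it
      stays in \<open>fc_centre\<close> and commutes with \<open>z\<close>.\<close>
    have *: "\<exists>t\<in>ball k. g \<otimes> inv t \<in> fc_centre \<inter> centralizer z" if "g \<in> ball n" for g n
      using that
    proof (induction n arbitrary: g)
      case 0
      then show ?case
        using subgroup.one_closed[OF sub] subgroup.one_closed[OF Cz]
        by (intro bexI[of _ "\<one>"]) (auto simp: ball_0)
    next
      case (Suc n)
      then obtain v s where vs: "v \<in> ball n" "s \<in> ball 1" "g = v \<otimes> s"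
        using ball_split[of g n 1] by auto
      obtain t where t: "t \<in> ball k" "v \<otimes> inv t \<in> fc_centre \<inter> centralizer z"
        using Suc.IH vs by blast
      have cl: "v \<in> carrier G" "s \<in> carrier G" "t \<in> carrier G" using vs t ball_closed by auto
      obtain t' where t': "t' \<in> ball k" "(t \<otimes> s) \<otimes> inv t' \<in> fc_centre"
        using assms cl unfolding syndetic_def by (meson m_closed)
      have t'c: "t' \<in> carrier G" using t' ball_closed by blast
      have "(t \<otimes> s) \<otimes> inv t' \<in> ball ((k + 1) + k)"
        by (intro ball_mult ball_inv t t' vs)
      then have "(t \<otimes> s) \<otimes> inv t' \<in> Y"
        using t'(2) by (simp add: Y_def mult_2 add.commute add.left_commute)
      then have "(t \<otimes> s) \<otimes> inv t' \<in> fc_centre \<inter> centralizer z"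
        using zY t' by blast
      then have "(v \<otimes> inv t) \<otimes> ((t \<otimes> s) \<otimes> inv t') \<in> fc_centre \<inter> centralizer z"
        using t subgroup.m_closed[OF sub] subgroup.m_closed[OF Cz] by auto
      moreover have "(v \<otimes> inv t) \<otimes> ((t \<otimes> s) \<otimes> inv t') = g \<otimes> inv t'"
        using cl t'c vs(3) by (simp add: m_assoc)
      ultimately show ?case using t' by auto
    qed
    have "z \<otimes> u = u \<otimes> z" if u: "u \<in> fc_centre" for u
    proof -
      have uc: "u \<in> carrier G" using u by (auto simp: fc_centre_def)
      obtain t where t: "t \<in> ball k" "u \<otimes> inv t \<in> fc_centre \<inter> centralizer z"
        using * in_ball_len[OF uc] by blast
      have tc: "t \<in> carrier G" using t ball_closed by blast
      \<comment> \<open>For \<open>u\<close> in \<open>fc_centre\<close> the last representative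
        \<open>t\<close> lies in \<open>fc_centre\<close> too, hence in \<open>Y\<close>, and so
        also commutes with \<open>z\<close>.\<close>
      have "inv (u \<otimes> inv t) \<otimes> u \<in> fc_centre"
        using t u subgroup.m_closed[OF sub] subgroup.m_inv_closed[OF sub] by blast
      moreover have "inv (u \<otimes> inv t) \<otimes> u = t" using uc tc by (simp add: inv_mult_group m_assoc)
      moreover have "t \<in> ball (2 * k + 1)" using t(1) ball_mono[of k "2 * k + 1"] by auto
      ultimately have "t \<in> centralizer z" using zY by (simp add: Y_def)
      then have "(u \<otimes> inv t) \<otimes> t \<in> centralizer z"
        using t subgroup.m_closed[OF Cz] by blast
      moreover have "(u \<otimes> inv t) \<otimes> t = u" using uc tc by (simp add: m_assoc)
      ultimately show ?thesis by (simp add: centralizer_def)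
    qed
    then show "z \<in> fc_kernel" using z unfolding fc_kernel_def by blast
  qed
  ultimately show ?thesis using syndetic_mono by blast
qed

section \<open>From many commuting pairs to finite index\<close>

definition commuting_pairs :: "nat \<Rightarrow> ('a \<times> 'a) set" where
  "commuting_pairs n = {(u, v). u \<in> ball n \<and> v \<in> ball n \<and> u \<otimes> v = v \<otimes> u}"

lemma card_commuting_pairs:
  "card (commuting_pairs n) = (\<Sum>u\<in>ball n. card (centralizer u \<inter> ball n))"
proof -
  have "commuting_pairs n = Sigma (ball n) (\<lambda>u. centralizer u \<inter> ball n)"
    using ball_closed by (auto simp: commuting_pairs_def centralizer_def)
  then show ?thesis by simp
qed

text \<open>By averaging, a proportion \<open>a\<close> of the ball has centralizers of density at
  least \<open>a\<close>. These centralizers are syndetic, so their elements lie in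
  \<open>fc_centre\<close>, which is thereby dense at the same radius and syndetic by a second use
  of \<open>dense_imp_syndetic\<close>.\<close>

lemma syndetic_fc_kernel_if_many_commuting:
  assumes K: "doubling_scales K" and a: "a > 0"
    and many: "\<exists>\<^sub>F n in sequentially. 2 * a * (real (card (ball n)))\<^sup>2 \<le> real (card (commuting_pairs n))"
  shows "\<exists>k. syndetic fc_kernel k"
proof -
  obtain k N where kN: "\<And>H n. subgroup H G \<Longrightarrow> n \<ge> N \<Longrightarrow>
      a * real (card (ball n)) \<le> real (card (H \<inter> ball n)) \<Longrightarrow> syndetic H k"
    using dense_imp_syndetic[OF K a] by metis
  obtain n where n: "n \<ge> N"
    "2 * a * (real (card (ball n)))\<^sup>2 \<le> real (card (commuting_pairs n))"
    using many unfolding frequently_sequentially by blast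
  define b where "b = real (card (ball n))"
  have b: "b > 0" using card_ball_pos by (simp add: b_def)
  define S where "S = {u \<in> ball n. a * b \<le> real (card (centralizer u \<inter> ball n))}"
  have S: "S \<subseteq> ball n" "finite S" unfolding S_def by auto
  have "real (card (commuting_pairs n)) = (\<Sum>u\<in>ball n. real (card (centralizer u \<inter> ball n)))"
    by (simp add: card_commuting_pairs)
  also have "\<dots> \<le> (\<Sum>u\<in>ball n. (if u \<in> S then b else 0) + a * b)"
  proof (rule sum_mono)
    fix u assume u: "u \<in> ball n"
    have "real (card (centralizer u \<inter> ball n)) \<le> b"
      unfolding b_def by (simp add: card_mono)
    moreover have "0 \<le> a * b" using a b by simp
    ultimately show "real (card (centralizer u \<inter> ball n)) \<le> (if u \<in> S then b else 0) + a * b"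
      using u by (auto simp: S_def)
  qed
  also have "\<dots> = real (card S) * b + b * (a * b)"
    using S by (simp add: sum.distrib sum.If_cases Int_absorb1 b_def)
  finally have "2 * a * b\<^sup>2 \<le> real (card S) * b + b * (a * b)"
    using n(2) by (simp add: b_def)
  then have "(a * b) * b \<le> real (card S) * b" by (simp add: power2_eq_square algebra_simps)
  then have "a * b \<le> real (card S)" using b by simp
  also have "S \<subseteq> fc_centre \<inter> ball n"
    using kN[OF subgroup_centralizer n(1)] ball_closed by (auto simp: S_def b_def fc_centre_def)
  then have "card S \<le> card (fc_centre \<inter> ball n)" by (simp add: card_mono)
  finally have "syndetic fc_centre k"
    using kN[OF subgroup_fc_centre n(1)] by (simp add: b_def)
  then show ?thesis by (rule syndetic_fc_kernel)
qed

section \<open>Halving the radius in virtually abelian groups\<close>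

text \<open>Each \<open>g\<close> in \<open>ball n\<close> factors as \<open>h \<otimes> t\<close>
  with \<open>t\<close> in \<open>ball k\<close> and \<open>h\<close> in \<open>H\<close>; the
  length of \<open>h\<close> is at most \<open>n + k\<close>. Finite index thus bounds density from
  below.\<close>

lemma card_ball_le_syndetic:
  assumes "syndetic H k"
  shows "card (ball n) \<le> card (ball k) * card (H \<inter> ball (n + k))"
proof -
  have "ball n \<subseteq> (\<lambda>(t, h). h \<otimes> t) ` (ball k \<times> (H \<inter> ball (n + k)))"
  proof
    fix g assume g: "g \<in> ball n"
    then obtain t where t: "t \<in> ball k" "g \<otimes> inv t \<in> H"
      using assms ball_closed unfolding syndetic_def by blast
    have "g \<otimes> inv t \<in> ball (n + k)" using g t by (intro ball_mult ball_inv)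
    moreover have "g = (g \<otimes> inv t) \<otimes> t"
      using ball_closed[OF g] ball_closed[OF t(1)] by (simp add: m_assoc)
    ultimately show "g \<in> (\<lambda>(t, h). h \<otimes> t) ` (ball k \<times> (H \<inter> ball (n + k)))"
      using t by (intro image_eqI[of _ _ "(t, g \<otimes> inv t)"]) auto
  qed
  then have "card (ball n) \<le> card (ball k \<times> (H \<inter> ball (n + k)))"
    by (intro surj_card_le) simp_all
  then show ?thesis by (simp add: card_cartesian_product)
qed

text \<open>The loops of a word representing an element of the abelian normal subgroup \<open>A\<close> can be pulled
  out one after the other, at the price of conjugating each of them. Hence such an element is a
  product of boundedly many conjugates \<open>t\<inverse> s t\<close>, raised to powers whose total weight is at most
  the length of the word; halving all exponents gives an approximate square root of half the
  length.\<close>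
lemma ball_halving:
  assumes A: "A \<lhd> G" "\<And>x y. x \<in> A \<Longrightarrow> y \<in> A \<Longrightarrow> x \<otimes> y = y \<otimes> x" and k: "syndetic A k"
  shows "\<exists>K C. \<forall>n. card (ball n) \<le> K * card (ball (n div 2 + C))"
proof -
  have sub: "subgroup A G" using A(1) by (rule normal_imp_subgroup)
  have Ac: "x \<in> carrier G" if "x \<in> A" for x using subgroup.mem_carrier[OF sub that] .
  let ?A = "G\<lparr>carrier := A\<rparr>"
  interpret A: comm_group ?A
    using group.group_comm_groupI[OF subgroup_imp_group[OF sub]] A(2) by simp
  \<comment> \<open>Of the \<open>p + 1\<close> prefixes of lengths 0 to \<open>p\<close>, two lie
    in the same coset, so a word longer than \<open>p\<close> contains a nonempty subword of length
    at most \<open>p\<close> with value in \<open>A\<close>. In a pair in \<open>I\<close> the first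
    entry is such a loop and the second a conjugator.\<close>
  define p where "p = card (rcosets A)"
  define I where "I = (A \<inter> ball p) \<times> ball k"
  have finI: "finite I" by (simp add: I_def)
  define val where "val = (\<lambda>(s, t). inv t \<otimes> s \<otimes> t)"
  have val: "val i \<in> A" if "i \<in> I" for i
    using that normal.inv_op_closed1[OF A(1)] ball_closed by (auto simp: val_def I_def)
  define ev where "ev f = finprod ?A (\<lambda>i. val i [^]\<^bsub>?A\<^esub> (f i :: nat)) I" for f
  have pow: "val i [^]\<^bsub>?A\<^esub> (m :: nat) \<in> A" if "i \<in> I" for i m
    using A.nat_pow_closed[of "val i" m] val[OF that] by simp
  have pow_add: "val i [^]\<^bsub>?A\<^esub> (m + l) = val i [^]\<^bsub>?A\<^esub> m \<otimes> val i [^]\<^bsub>?A\<^esub> l"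
    if "i \<in> I" for i and m l :: nat
    using A.nat_pow_mult[of "val i" m l] val[OF that] by simp
  have ev_add: "ev (\<lambda>i. f i + g i) = ev f \<otimes> ev g" for f g
  proof -
    have "ev (\<lambda>i. f i + g i)
        = finprod ?A (\<lambda>i. val i [^]\<^bsub>?A\<^esub> f i \<otimes>\<^bsub>?A\<^esub> val i [^]\<^bsub>?A\<^esub> g i) I"
      unfolding ev_def using pow pow_add subgroup.m_closed[OF sub pow pow]
      by (intro A.finprod_cong') auto
    also have "\<dots> = ev f \<otimes> ev g"
      unfolding ev_def using pow by (subst A.finprod_multf) auto
    finally show ?thesis .
  qed
  have ev_single: "ev (\<lambda>j. if i = j then 1 else 0) = val i" if "i \<in> I" for i
  proof -
    have "ev (\<lambda>j. if i = j then 1 else 0) = finprod ?A (\<lambda>j. if i = j then val j else \<one>\<^bsub>?A\<^esub>) I"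
      unfolding ev_def using val subgroup.one_closed[OF sub] Ac[OF val]
      by (intro A.finprod_cong') auto
    also have "\<dots> = val i"
      using val that finI by (intro A.finprod_singleton) auto
    finally show ?thesis .
  qed
  \<comment> \<open>A factor is charged the length of its loop and not that of the conjugate: the
    conjugators cost at most \<open>2 * k\<close> per index, whatever the exponent.\<close>
  define wt where "wt f = (\<Sum>i\<in>I. f i * len (fst i))" for f
  have wt_add: "wt (\<lambda>i. f i + g i) = wt f + wt g" for f g
    unfolding wt_def by (simp add: sum.distrib distrib_right)
  have wt_single: "wt (\<lambda>j. if i = j then 1 else 0) = len (fst i)" if "i \<in> I" for i
  proof -
    have "wt (\<lambda>j. if i = j then 1 else 0) = (\<Sum>j\<in>I. if i = j then len (fst j) else 0)"
      unfolding wt_def by (intro sum.cong) auto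
    then show ?thesis using that finI by simp
  qed
  have fin_rcos: "finite (rcosets A)"
    using k syndetic_iff_finite_rcosets[OF sub] by blast
  have loops: "\<exists>f. ev f = word_product G ws \<and> wt f \<le> length ws"
    if "set ws \<subseteq> letters" "word_product G ws \<in> A" for ws
    using that
  proof (induction "length ws" arbitrary: ws rule: less_induct)
    case less
    let ?w = "word_product G ws"
    show ?case
    proof (cases "length ws \<le> p")
      case True
      then have "?w \<in> ball p" using less.prems(1) unfolding ball_iff by blast
      then have w: "(?w, \<one>) \<in> I" using less.prems(2) by (simp add: I_def)
      have "val (?w, \<one>) = ?w" using Ac[OF less.prems(2)] by (simp add: val_def)
      then have "ev (\<lambda>j. if (?w, \<one>) = j then 1 else 0) = ?w"
        "wt (\<lambda>j. if (?w, \<one>) = j then 1 else 0) \<le> length ws"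
        using ev_single[OF w] wt_single[OF w] len_le[OF less.prems(1)] by simp_all
      then show ?thesis by blast
    next
      case False
      let ?c = "\<lambda>i. A #> word_product G (take i ws)"
      have letters_part: "set (take i ws) \<subseteq> letters" "set (drop i ws) \<subseteq> letters" for i
        using less.prems(1) set_take_subset[of i ws] set_drop_subset[of i ws] by auto
      have "?c ` {0..p} \<subseteq> rcosets A"
        using word_product_closed[OF letters_part(1)] by (auto simp: RCOSETS_def)
      then have "card (?c ` {0..p}) \<le> p" unfolding p_def by (intro card_mono fin_rcos)
      then have "\<not> inj_on ?c {0..p}" by (intro pigeonhole) simp
      then obtain i' j' where "i' \<le> p" "j' \<le> p" "i' \<noteq> j'" "?c i' = ?c j'"
        by (auto simp: inj_on_def)
      then obtain i j where ij: "i < j" "j \<le> p" "?c i = ?c j"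
        by (metis linorder_neqE_nat)
      define x where "x = word_product G (take i ws)"
      define s where "s = word_product G (drop i (take j ws))"
      define q where "q = word_product G (drop j ws)"
      have mid: "set (drop i (take j ws)) \<subseteq> letters"
        using letters_part(1)[of j] set_drop_subset[of i "take j ws"] by blast
      have cl: "x \<in> carrier G" "s \<in> carrier G" "q \<in> carrier G"
        unfolding x_def s_def q_def using word_product_closed letters_part mid by blast+
      have "take j ws = take i ws @ drop i (take j ws)"
        using ij(1) by (metis append_take_drop_id less_imp_le min.absorb1 take_take)
      then have xs: "word_product G (take j ws) = x \<otimes> s"
        unfolding x_def s_def using word_product_append letters_part(1) mid by metis
      have w: "?w = x \<otimes> s \<otimes> q"
        using word_product_append[OF letters_part, of j j] xs by (simp add: q_def)
      have "x \<otimes> s \<otimes> inv x \<in> A"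
        using ij(3) xs rcos_eq_iff[OF sub, of "x \<otimes> s" x] cl by (simp add: x_def)
      then have "inv x \<otimes> (x \<otimes> s \<otimes> inv x) \<otimes> x \<in> A"
        using normal.inv_op_closed1[OF A(1) cl(1)] by blast
      then have sA: "s \<in> A" using cl by (simp add: m_assoc)
      have slen: "len s \<le> j - i" unfolding s_def using len_le[OF mid] ij by simp
      \<comment> \<open>Moving \<open>s\<close> past \<open>q\<close> conjugates it by
        \<open>q\<close>. As \<open>q\<close> is \<open>?a \<otimes> t\<close> with
        \<open>?a\<close> in \<open>A\<close> commuting with \<open>s\<close>, this equals
        conjugation by \<open>t\<close>, so boundedly many conjugators suffice.\<close>
      obtain t where t: "t \<in> ball k" "q \<otimes> inv t \<in> A"
        using k cl(3) unfolding syndetic_def by blast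
      have tc: "t \<in> carrier G" using t ball_closed by blast
      have st: "(s, t) \<in> I" using sA slen ij t cl by (auto simp: I_def cayley_ball_def)
      let ?a = "q \<otimes> inv t"
      have ac: "?a \<in> carrier G" using Ac t by blast
      have comm: "s \<otimes> ?a = ?a \<otimes> s" using A(2) sA t(2) by blast
      have "q \<otimes> val (s, t) = ?a \<otimes> s \<otimes> t"
        using ac cl tc by (simp add: val_def m_assoc)
      also have "\<dots> = s \<otimes> ?a \<otimes> t" by (simp only: comm)
      also have "\<dots> = s \<otimes> q" using ac cl tc by (simp add: m_assoc)
      finally have qs: "q \<otimes> val (s, t) = s \<otimes> q" .
      have vc: "val (s, t) \<in> carrier G" using val[OF st] Ac by blast
      have w': "?w = (x \<otimes> q) \<otimes> val (s, t)"
        using w qs cl vc by (simp add: m_assoc)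
      have "x \<otimes> q = ?w \<otimes> inv (val (s, t))"
        using w' cl vc by (simp add: m_assoc)
      then have xqA: "x \<otimes> q \<in> A"
        using subgroup.m_closed[OF sub less.prems(2) subgroup.m_inv_closed[OF sub val[OF st]]] by simp
      let ?v = "take i ws @ drop j ws"
      have v: "word_product G ?v = x \<otimes> q"
        unfolding x_def q_def using word_product_append letters_part by blast
      have vlen: "length ?v + (j - i) = length ws" using ij False by simp
      have "\<exists>f. ev f = word_product G ?v \<and> wt f \<le> length ?v"
      proof (rule less.hyps)
        show "length ?v < length ws" using vlen ij by linarith
        show "set ?v \<subseteq> letters" using letters_part by simp
        show "word_product G ?v \<in> A" using v xqA by simp
      qed
      then obtain f where f: "ev f = x \<otimes> q" "wt f \<le> length ?v" using v by metis
      have "ev (\<lambda>i. f i + (if (s, t) = i then 1 else 0)) = ?w"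
        using ev_add ev_single[OF st] f w' by simp
      moreover have "wt (\<lambda>i. f i + (if (s, t) = i then 1 else 0)) \<le> length ws"
        using wt_add wt_single[OF st] f(2) slen vlen by simp
      ultimately show ?thesis by blast
    qed
  qed
  have ev_ball: "ev f \<in> ball (wt f + 2 * k * card I)" for f
  proof -
    \<comment> \<open>In a power of \<open>inv t \<otimes> s \<otimes> t\<close> the inner
      conjugators cancel.\<close>
    have pow_ball: "val i [^]\<^bsub>?A\<^esub> (m :: nat) \<in> ball (m * len (fst i) + 2 * k)" if "i \<in> I" for i m
    proof -
      obtain s t where st: "i = (s, t)" "s \<in> A" "t \<in> ball k" using \<open>i \<in> I\<close> by (auto simp: I_def)
      have c: "s \<in> carrier G" "t \<in> carrier G" using st Ac ball_closed by auto
      have v: "val i = inv t \<otimes> s \<otimes> t" by (simp add: st(1) val_def)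
      have eq: "val i [^]\<^bsub>?A\<^esub> m = inv t \<otimes> s [^] m \<otimes> t"
      proof (induction m)
        case 0
        then show ?case using c by simp
      next
        case (Suc m)
        have "val i [^]\<^bsub>?A\<^esub> Suc m = (inv t \<otimes> s [^] m \<otimes> t) \<otimes> val i" by (simp add: Suc)
        also have "\<dots> = inv t \<otimes> s [^] Suc m \<otimes> t" using c by (simp add: v m_assoc)
        finally show ?case .
      qed
      have "s [^] m \<in> ball (m * len s)"
      proof (induction m)
        case (Suc m)
        then show ?case using ball_mult[OF Suc in_ball_len[OF c(1)]] by (simp add: add.commute)
      qed simp
      then have "inv t \<otimes> s [^] m \<otimes> t \<in> ball ((k + m * len s) + k)"
        using st by (intro ball_mult ball_inv)
      moreover have "(k + m * len s) + k = m * len (fst i) + 2 * k" by (simp add: st(1))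
      ultimately show ?thesis using eq by metis
    qed
    have "finprod ?A (\<lambda>i. val i [^]\<^bsub>?A\<^esub> (f i :: nat)) J
        \<in> ball ((\<Sum>i\<in>J. f i * len (fst i)) + 2 * k * card J)" if "J \<subseteq> I" for J
      using finite_subset[OF that finI] that
    proof (induction J)
      case empty
      then show ?case by simp
    next
      case (insert i J)
      have "finprod ?A (\<lambda>i. val i [^]\<^bsub>?A\<^esub> f i) (insert i J)
          = val i [^]\<^bsub>?A\<^esub> f i \<otimes> finprod ?A (\<lambda>i. val i [^]\<^bsub>?A\<^esub> f i) J"
        using insert pow by (subst A.finprod_insert) auto
      moreover have "val i [^]\<^bsub>?A\<^esub> f i \<otimes> finprod ?A (\<lambda>i. val i [^]\<^bsub>?A\<^esub> f i) J
          \<in> ball ((f i * len (fst i) + 2 * k) + ((\<Sum>i\<in>J. f i * len (fst i)) + 2 * k * card J))"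
        using insert by (intro ball_mult pow_ball) auto
      moreover have "(f i * len (fst i) + 2 * k) + ((\<Sum>i\<in>J. f i * len (fst i)) + 2 * k * card J)
          = (\<Sum>i\<in>insert i J. f i * len (fst i)) + 2 * k * card (insert i J)"
        using insert by simp
      ultimately show ?case by metis
    qed
    then show ?thesis by (auto simp: ev_def wt_def)
  qed
  define C where "C = 2 * k * card I"
  \<comment> \<open>Exponents modulo 2 are indicators of subsets of \<open>I\<close>, so only
    finitely many error terms occur.\<close>
  define E where "E = (\<lambda>S. ev (\<lambda>i. if i \<in> S then 1 else 0)) ` Pow I"
  have finE: "finite E" by (simp add: E_def finI)
  have half: "card (A \<inter> ball n) \<le> card E * card (ball (n div 2 + C))" for n
  proof -
    have "A \<inter> ball n \<subseteq> (\<lambda>(e, h). h \<otimes> h \<otimes> e) ` (E \<times> ball (n div 2 + C))"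
    proof
      fix g assume g: "g \<in> A \<inter> ball n"
      then have "g \<in> ball n" "g \<in> A" by auto
      then obtain ws where ws: "length ws \<le> n" "set ws \<subseteq> letters" "word_product G ws = g"
        unfolding ball_iff by blast
      then obtain f where f: "ev f = g" "wt f \<le> n"
        using loops[OF ws(2)] \<open>g \<in> A\<close> by (auto intro: le_trans)
      let ?h = "\<lambda>i. f i div 2" and ?e = "\<lambda>i. f i mod 2"
      have "f = (\<lambda>i. (?h i + ?h i) + ?e i)" by (rule ext) presburger
      then have "ev f = ev (\<lambda>i. (?h i + ?h i) + ?e i)" by (rule arg_cong)
      then have g_eq: "g = ev ?h \<otimes> ev ?h \<otimes> ev ?e"
        unfolding ev_add f(1) .
      have "2 * wt ?h = (\<Sum>i\<in>I. 2 * (f i div 2) * len (fst i))"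
        unfolding wt_def by (simp add: sum_distrib_left mult.assoc)
      also have "\<dots> \<le> wt f"
        unfolding wt_def by (intro sum_mono mult_right_mono) auto
      finally have "wt ?h \<le> n div 2" using f(2) by simp
      then have "ev ?h \<in> ball (n div 2 + C)"
        using ev_ball[of ?h] ball_mono[of "wt ?h + C" "n div 2 + C"] by (auto simp: C_def)
      moreover have "ev ?e \<in> E"
      proof -
        have "ev ?e = ev (\<lambda>i. if i \<in> {i \<in> I. odd (f i)} then 1 else 0)"
          unfolding ev_def
        proof (rule A.finprod_cong')
          fix i assume i: "i \<in> I"
          have "f i mod 2 = (if i \<in> {i \<in> I. odd (f i)} then 1 else 0)"
            using i by (simp add: odd_iff_mod_2_eq_one)
          then show "val i [^]\<^bsub>?A\<^esub> (f i mod 2)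
              = val i [^]\<^bsub>?A\<^esub> (if i \<in> {i \<in> I. odd (f i)} then 1 else 0 :: nat)"
            by (rule arg_cong)
        qed (use pow in auto)
        then show ?thesis unfolding E_def by blast
      qed
      ultimately show "g \<in> (\<lambda>(e, h). h \<otimes> h \<otimes> e) ` (E \<times> ball (n div 2 + C))"
        using g_eq by (intro image_eqI[of _ _ "(ev ?e, ev ?h)"]) auto
    qed
    then have "card (A \<inter> ball n) \<le> card (E \<times> ball (n div 2 + C))"
      using finE by (intro surj_card_le) simp_all
    then show ?thesis by (simp add: card_cartesian_product)
  qed
  have "card (ball n) \<le> (card (ball k) * card E) * card (ball (n div 2 + (k + C)))" for n
  proof -
    have "card (ball n) \<le> card (ball k) * card (A \<inter> ball (n + k))"
      by (rule card_ball_le_syndetic[OF k])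
    also have "\<dots> \<le> card (ball k) * (card E * card (ball ((n + k) div 2 + C)))"
      by (intro mult_left_mono half) simp
    also have "\<dots> \<le> card (ball k) * (card E * card (ball (n div 2 + (k + C))))"
      by (intro mult_left_mono card_ball_mono) auto
    finally show ?thesis by (simp add: mult.assoc)
  qed
  then show ?thesis by blast
qed

section \<open>Thin annuli are negligible\<close>

text \<open>Pairs at distance at most \<open>3 * r\<close> between the two annuli are counted twice.
  An outer point \<open>x\<close> sees a translate of \<open>ball (r - 1)\<close> around the point
  \<open>y\<close> at distance \<open>n - 2 * r\<close> from the identity on a geodesic to
  \<open>x\<close>; an inner point sees at most \<open>card (ball (3 * r))\<close> outer
  points.\<close>

lemma card_annulus_le:
  assumes r: "r \<ge> 1" "3 * r \<le> n"
  shows "card (ball n - ball (n - r)) * card (ball (r - 1))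
    \<le> card (ball (3 * r)) * card (ball (n - r) - ball (n - 3 * r))"
proof -
  let ?O = "ball n - ball (n - r)" and ?I = "ball (n - r) - ball (n - 3 * r)"
  have inner: "card (ball (r - 1)) \<le> card {z \<in> ?I. inv z \<otimes> x \<in> ball (3 * r)}" if x: "x \<in> ?O" for x
  proof -
    have xc: "x \<in> carrier G" using x ball_closed by blast
    define l where "l = len x"
    have l: "l \<le> n" "l > n - r" using x xc by (auto simp: l_def cayley_ball_def)
    have "x \<in> ball ((n - 2 * r) + (l - (n - 2 * r)))"
      using in_ball_len[OF xc] l r by (simp add: l_def)
    then obtain y v where yv: "y \<in> ball (n - 2 * r)" "v \<in> ball (l - (n - 2 * r))" "x = y \<otimes> v"
      by (rule ball_split)
    have cl: "y \<in> carrier G" "v \<in> carrier G" using yv ball_closed by auto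
    have "inj_on ((\<otimes>) y) (ball (r - 1))"
      using inj_on_subset[OF inj_on_cmult[OF cl(1)]] ball_closed by blast
    then have "card (ball (r - 1)) = card ((\<otimes>) y ` ball (r - 1))" by (simp add: card_image)
    also have "\<dots> \<le> card {z \<in> ?I. inv z \<otimes> x \<in> ball (3 * r)}"
    proof (intro card_mono)
      show "(\<otimes>) y ` ball (r - 1) \<subseteq> {z \<in> ?I. inv z \<otimes> x \<in> ball (3 * r)}"
      proof clarify
        fix u assume u: "u \<in> ball (r - 1)"
        have uc: "u \<in> carrier G" using u ball_closed by blast
        have "y \<otimes> u \<in> ball ((n - 2 * r) + (r - 1))" by (rule ball_mult[OF yv(1) u])
        then have "y \<otimes> u \<in> ball (n - r)"
          by (rule subsetD[OF ball_mono, rotated]) (use r in linarith)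
        \<comment> \<open>Radius \<open>r - 1\<close> instead of \<open>r\<close> is what keeps the
          translate strictly outside \<open>ball (n - 3 * r)\<close>.\<close>
        moreover have "y \<otimes> u \<notin> ball (n - 3 * r)"
        proof
          assume "y \<otimes> u \<in> ball (n - 3 * r)"
          from ball_mult[OF ball_mult[OF this ball_inv[OF u]] yv(2)]
          have "x \<in> ball ((n - 3 * r) + (r - 1) + (l - (n - 2 * r)))"
            using cl uc yv(3) by (simp add: m_assoc)
          then have "l \<le> (n - 3 * r) + (r - 1) + (l - (n - 2 * r))"
            by (simp add: cayley_ball_def l_def)
          then show False using l r by linarith
        qed
        moreover have "inv (y \<otimes> u) \<otimes> x \<in> ball (3 * r)"
        proof -
          have "inv u \<otimes> v \<in> ball ((r - 1) + (l - (n - 2 * r)))"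
            by (rule ball_mult[OF ball_inv[OF u] yv(2)])
          moreover have "(r - 1) + (l - (n - 2 * r)) \<le> 3 * r" using l r by simp
          ultimately have "inv u \<otimes> v \<in> ball (3 * r)" using ball_mono by blast
          moreover have "inv (y \<otimes> u) \<otimes> x = inv u \<otimes> v"
            using cl uc yv(3) by (simp add: inv_mult_group m_assoc)
          ultimately show ?thesis by simp
        qed
        ultimately show "y \<otimes> u \<in> ?I \<and> inv (y \<otimes> u) \<otimes> x \<in> ball (3 * r)" by blast
      qed
    qed simp
    finally show ?thesis .
  qed
  have outer: "card {x \<in> ?O. inv z \<otimes> x \<in> ball (3 * r)} \<le> card (ball (3 * r))" if z: "z \<in> ?I" for z
  proof -
    have zc: "inv z \<in> carrier G" using z ball_closed by auto
    have "inj_on ((\<otimes>) (inv z)) {x \<in> ?O. inv z \<otimes> x \<in> ball (3 * r)}"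
      using ball_closed by (intro inj_on_subset[OF inj_on_cmult[OF zc]]) blast
    then show ?thesis by (rule card_inj_on_le) auto
  qed
  have "card ?O * card (ball (r - 1)) = (\<Sum>x\<in>?O. card (ball (r - 1)))" by simp
  also have "\<dots> \<le> (\<Sum>x\<in>?O. card {z \<in> ?I. inv z \<otimes> x \<in> ball (3 * r)})"
    using inner by (rule sum_mono)
  also have "\<dots> = (\<Sum>z\<in>?I. card {x \<in> ?O. inv z \<otimes> x \<in> ball (3 * r)})"
    by (rule sum_multicount_gen) auto
  also have "\<dots> \<le> (\<Sum>z\<in>?I. card (ball (3 * r)))"
    using outer by (rule sum_mono)
  finally show ?thesis by (simp add: mult.commute)
qed

text \<open>Doubling forces every annulus to be a definite proportion of the annulus three times as
  thick, so a thin annulus is a negligible part of the ball.\<close>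
lemma ball_growth_negligible:
  assumes half: "\<forall>n. card (ball n) \<le> K * card (ball (n div 2 + C))" and e: "(e :: real) > 0"
  shows "\<exists>N. \<forall>n\<ge>N. real (card (ball (n + 3))) \<le> (1 + e) * real (card (ball n))"
proof -
  let ?b = "\<lambda>n. real (card (ball n))"
  have "0 < card (ball 0)" by (rule card_ball_pos)
  also have "\<dots> \<le> K * card (ball (0 div 2 + C))" using half by blast
  finally have K: "K > 0" by (simp only: nat_0_less_mult_iff)
  define L where "L = real (K * K)"
  have L: "L > 0" using K by (simp add: L_def)
  \<comment> \<open>Two halvings turn \<open>3 * r\<close> into at most 3r/4 + 3C/2, which is at
    most \<open>r - 1\<close> exactly when \<open>r\<close> is at least
    \<open>6 * C + 4\<close>.\<close>
  define R where "R = 6 * C + 4"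
  have tripling: "?b (3 * r) \<le> L * ?b (r - 1)" if "r \<ge> R" for r
  proof -
    have "card (ball (3 * r)) \<le> K * card (ball (3 * r div 2 + C))" using half by blast
    also have "\<dots> \<le> K * (K * card (ball ((3 * r div 2 + C) div 2 + C)))"
      using half by (intro mult_left_mono) auto
    also have "\<dots> \<le> K * (K * card (ball (r - 1)))"
      using that by (intro mult_left_mono card_ball_mono) (auto simp: R_def)
    finally show ?thesis by (simp add: L_def mult.assoc flip: of_nat_mult)
  qed
  define ann where "ann n r = ?b n - ?b (n - r)" for n r
  have card_diff: "real (card (ball m - ball l)) = ?b m - ?b l" if "l \<le> m" for l m
    using that by (simp add: card_Diff_subset ball_mono card_ball_mono of_nat_diff)
  \<comment> \<open>By \<open>tripling\<close>, the added layers contain at least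
    \<open>1 / L\<close> of the old annulus, so tripling the thickness multiplies the annulus by at
    least \<open>q\<close>.\<close>
  define q where "q = 1 + 1 / L"
  have q: "q > 1" using L by (simp add: q_def)
  have step: "q * ann n r \<le> ann n (3 * r)" if r: "r \<ge> R" "3 * r \<le> n" for n r
  proof -
    have r1: "r \<ge> 1" using r by (simp add: R_def)
    have "ann n r * ?b (r - 1) = real (card (ball n - ball (n - r)) * card (ball (r - 1)))"
      by (simp add: card_diff ann_def)
    also have "\<dots> \<le> real (card (ball (3 * r)) * card (ball (n - r) - ball (n - 3 * r)))"
      using card_annulus_le[OF r1 r(2)] by (rule of_nat_mono)
    also have "\<dots> = ?b (3 * r) * (ann n (3 * r) - ann n r)"
      by (simp add: card_diff ann_def)
    also have "\<dots> \<le> (L * ?b (r - 1)) * (ann n (3 * r) - ann n r)"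
      using tripling[OF r(1)] card_ball_mono[of "n - 3 * r" "n - r"]
      by (intro mult_right_mono) (auto simp: ann_def)
    finally have "ann n r * ?b (r - 1) \<le> (L * (ann n (3 * r) - ann n r)) * ?b (r - 1)"
      by (simp add: mult_ac)
    then have "ann n r \<le> L * (ann n (3 * r) - ann n r)"
      using card_ball_pos[of "r - 1"] by simp
    then show ?thesis using L by (simp add: q_def field_simps)
  qed
  have iterate: "q ^ j * ann n r \<le> ann n (3 ^ j * r)" if "r \<ge> R" "3 ^ j * r \<le> n" for n r j
    using that(2)
  proof (induction j)
    case (Suc j)
    have le: "3 * (3 ^ j * r) \<le> n" "3 ^ j * r \<le> n" using Suc.prems by auto
    have "r \<le> 3 ^ j * r" by simp
    then have "R \<le> 3 ^ j * r" using that(1) by linarith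
    have "q ^ Suc j * ann n r \<le> q * ann n (3 ^ j * r)"
      using Suc.IH[OF le(2)] q by (simp add: mult.assoc mult_left_mono)
    also have "\<dots> \<le> ann n (3 ^ Suc j * r)"
      using step[OF \<open>R \<le> 3 ^ j * r\<close> le(1)] by (simp add: mult.assoc)
    finally show ?case .
  qed simp
  \<comment> \<open>With this \<open>j\<close> the annulus of thickness \<open>r\<close> is at most
    the fraction e/(1 + e) of the ball. Taking \<open>r\<close> at least 3 puts the inner radius
    \<open>n + 3 - r\<close> below \<open>n\<close>.\<close>
  obtain j where j: "(1 + e) / e < q ^ j" using real_arch_pow[OF q] by blast
  define r where "r = R + 3"
  have "?b (n + 3) \<le> (1 + e) * ?b n" if n: "n \<ge> 3 ^ j * r" for n
  proof -
    have "q ^ j * ann (n + 3) r \<le> ann (n + 3) (3 ^ j * r)"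
      using n by (intro iterate) (auto simp: r_def)
    also have "\<dots> \<le> ?b (n + 3)" by (simp add: ann_def)
    finally have "q ^ j * ann (n + 3) r \<le> ?b (n + 3)" .
    moreover have "(1 + e) / e * ann (n + 3) r \<le> q ^ j * ann (n + 3) r"
      using j card_ball_mono[of "n + 3 - r" "n + 3"] by (intro mult_right_mono) (auto simp: ann_def)
    ultimately have "(1 + e) / e * ann (n + 3) r \<le> ?b (n + 3)" by linarith
    then have "(1 + e) * ann (n + 3) r \<le> e * ?b (n + 3)"
      using e by (simp add: field_simps)
    then have "?b (n + 3) \<le> (1 + e) * ?b (n + 3 - r)"
      by (simp add: ann_def algebra_simps)
    also have "\<dots> \<le> (1 + e) * ?b n"
      using e card_ball_mono[of "n + 3 - r" n] by (intro mult_left_mono) (auto simp: r_def)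
    finally show ?thesis .
  qed
  then show ?thesis by blast
qed

section \<open>The degree of commutativity without limits superior\<close>

text \<open>A strict lower bound on a limsup leaves room for some slack \<open>e\<close> and is then
  met at arbitrarily large radii; conversely the slack keeps the bound strict in the limit.\<close>

lemma degree_of_commutativity_gt_iff:
  "degree_of_commutativity G X > ereal c \<longleftrightarrow>
    (\<exists>e>0. \<exists>\<^sub>F n in sequentially. (c + e) * (real (card (ball n)))\<^sup>2 \<le> real (card (commuting_pairs n)))"
proof -
  define f where "f n = real (card (commuting_pairs n)) / (real (card (ball n)))\<^sup>2" for n
  have dc: "degree_of_commutativity G X = limsup (\<lambda>n. ereal (f n))"
    by (simp add: degree_of_commutativity_def f_def commuting_pairs_def)
  have f: "d \<le> f n \<longleftrightarrow> d * (real (card (ball n)))\<^sup>2 \<le> real (card (commuting_pairs n))" for d n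
    using card_ball_pos[of n] by (simp add: f_def pos_le_divide_eq)
  have "ereal c < limsup (\<lambda>n. ereal (f n)) \<longleftrightarrow> (\<exists>e>0. \<exists>\<^sub>F n in sequentially. c + e \<le> f n)"
  proof
    assume "ereal c < limsup (\<lambda>n. ereal (f n))"
    then obtain y where y: "c < y" "ereal y < limsup (\<lambda>n. ereal (f n))"
      using ereal_dense2 by force
    have "\<exists>\<^sub>F n in sequentially. y \<le> f n"
    proof (rule ccontr)
      assume "\<not> ?thesis"
      then have "\<forall>\<^sub>F n in sequentially. ereal (f n) \<le> ereal y"
        unfolding not_frequently by (rule eventually_mono) simp
      then have "limsup (\<lambda>n. ereal (f n)) \<le> ereal y" by (rule Limsup_bounded)
      then show False using y(2) by simp
    qed
    then show "\<exists>e>0. \<exists>\<^sub>F n in sequentially. c + e \<le> f n"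
      using y(1) by (intro exI[of _ "y - c"]) simp
  next
    assume "\<exists>e>0. \<exists>\<^sub>F n in sequentially. c + e \<le> f n"
    then obtain e where e: "e > 0" "\<exists>\<^sub>F n in sequentially. c + e \<le> f n" by blast
    have "\<not> limsup (\<lambda>n. ereal (f n)) < ereal (c + e)"
    proof
      assume "limsup (\<lambda>n. ereal (f n)) < ereal (c + e)"
      then have "\<forall>\<^sub>F n in sequentially. ereal (f n) < ereal (c + e)" by (rule Limsup_lessD)
      then have "\<forall>\<^sub>F n in sequentially. \<not> c + e \<le> f n" by (rule eventually_mono) simp
      then show False using e(2) unfolding frequently_def by blast
    qed
    moreover have "ereal c < ereal (c + e)" using e(1) by simp
    ultimately show "ereal c < limsup (\<lambda>n. ereal (f n))"
      by (metis not_less order_less_le_trans)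
  qed
  then show ?thesis unfolding dc f .
qed

section \<open>Index of the centre and the 5/8 bound\<close>

definition centre :: "'a set" where
  "centre = {z \<in> carrier G. \<forall>g\<in>carrier G. z \<otimes> g = g \<otimes> z}"

lemma centreD: "z \<in> centre \<Longrightarrow> z \<in> carrier G" "z \<in> centre \<Longrightarrow> g \<in> carrier G \<Longrightarrow> z \<otimes> g = g \<otimes> z"
  unfolding centre_def by blast+

lemma subgroup_centre: "subgroup centre G"
proof (rule subgroupI)
  show "centre \<subseteq> carrier G" by (auto simp: centre_def)
  have "\<one> \<in> centre" by (simp add: centre_def)
  then show "centre \<noteq> {}" by blast
  show "inv z \<in> centre" if z: "z \<in> centre" for z
  proof -
    have "inv z \<otimes> g = g \<otimes> inv z" if "g \<in> carrier G" for g
      using commute_inv[OF centreD(1)[OF z] that centreD(2)[OF z that]] .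
    then show ?thesis using centreD(1)[OF z] unfolding centre_def by blast
  qed
  show "z \<otimes> z' \<in> centre" if z: "z \<in> centre" "z' \<in> centre" for z z'
  proof -
    have "z \<otimes> z' \<otimes> g = g \<otimes> (z \<otimes> z')" if "g \<in> carrier G" for g
      using commute_mult[OF centreD(1)[OF z(1)] centreD(1)[OF z(2)] that
          centreD(2)[OF z(1) that] centreD(2)[OF z(2) that]] .
    then show ?thesis using centreD(1) z unfolding centre_def by blast
  qed
qed

text \<open>The centre of a nonabelian group has index at least 4, here with representatives in
  \<open>ball 3\<close>. Either some coset misses \<open>ball 2\<close>, and the general count
  already gives 4 cosets, or all cosets meet \<open>ball 3\<close>, and those of
  \<open>\<one>\<close>, \<open>u\<close>, \<open>v\<close> and \<open>u \<otimes> v\<close> are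
  distinct.\<close>

lemma card_cosets_centre:
  assumes u: "u \<in> carrier G" and v: "v \<in> carrier G" and uv: "u \<otimes> v \<noteq> v \<otimes> u"
  shows "4 \<le> card (cosets_in_ball centre 3)"
proof (cases "syndetic centre 2")
  case False
  then show ?thesis using card_cosets_in_ball[OF subgroup_centre False] by (simp add: eval_nat_numeral)
next
  case True
  note Z = subgroup_centre
  have mem: "centre #> g \<in> cosets_in_ball centre 3" if g: "g \<in> carrier G" for g
  proof -
    obtain t where t: "t \<in> ball 2" "g \<otimes> inv t \<in> centre"
      using True g unfolding syndetic_def by blast
    then have "centre #> g = centre #> t" using rcos_eq_iff[OF Z g] ball_closed by blast
    moreover have "t \<in> ball 3" using t(1) ball_mono[of 2 3] by auto
    ultimately show ?thesis unfolding cosets_in_ball_def by blast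
  qed
  have coset: "\<exists>z\<in>centre. g = z \<otimes> h"
    if "centre #> g = centre #> h" "g \<in> carrier G" "h \<in> carrier G" for g h
  proof -
    have "g \<otimes> inv h \<in> centre" using that rcos_eq_iff[OF Z] by blast
    moreover have "g = (g \<otimes> inv h) \<otimes> h" using that by (simp add: m_assoc)
    ultimately show ?thesis by blast
  qed
  have ncentre: "u \<notin> centre" "v \<notin> centre" using centreD(2) u v uv by metis+
  have "centre #> u \<noteq> centre #> \<one>"
    using coset[OF _ u one_closed] ncentre centreD(1) by force
  moreover have "centre #> v \<noteq> centre #> \<one>"
    using coset[OF _ v one_closed] ncentre centreD(1) by force
  moreover have "centre #> u \<noteq> centre #> v"
  proof
    assume "centre #> u = centre #> v"
    then obtain z where z: "z \<in> centre" "u = z \<otimes> v" using coset u v by blast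
    have "(z \<otimes> v) \<otimes> v = v \<otimes> (z \<otimes> v)"
      using commute_mult[OF centreD(1)[OF z(1)] v v centreD(2)[OF z(1) v] refl] .
    then show False using uv z(2) by simp
  qed
  moreover have "centre #> (u \<otimes> v) \<noteq> centre #> \<one>"
  proof
    assume "centre #> (u \<otimes> v) = centre #> \<one>"
    then obtain z where z: "z \<in> centre" "u \<otimes> v = z \<otimes> \<one>" using coset u v by blast
    then have "u \<otimes> v \<in> centre" using centreD(1) by simp
    then have "(u \<otimes> v) \<otimes> u = u \<otimes> (u \<otimes> v)" using centreD(2) u by blast
    then show False using u v uv by (simp add: m_assoc)
  qed
  moreover have "centre #> (u \<otimes> v) \<noteq> centre #> u"
  proof
    assume "centre #> (u \<otimes> v) = centre #> u"
    then obtain z where z: "z \<in> centre" "u \<otimes> v = z \<otimes> u" using coset u v by blast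
    then have "u \<otimes> v = u \<otimes> z" using centreD(2) u by simp
    then have "v = z" using u v centreD(1)[OF z(1)] by simp
    then show False using z ncentre by simp
  qed
  moreover have "centre #> (u \<otimes> v) \<noteq> centre #> v"
  proof
    assume "centre #> (u \<otimes> v) = centre #> v"
    then obtain z where z: "z \<in> centre" "u \<otimes> v = z \<otimes> v" using coset u v by blast
    then have "u = z" using u v centreD(1)[OF z(1)] by simp
    then show False using z ncentre by simp
  qed
  ultimately have "card {centre #> \<one>, centre #> u, centre #> v, centre #> (u \<otimes> v)} = 4"
    by auto
  moreover have "{centre #> \<one>, centre #> u, centre #> v, centre #> (u \<otimes> v)} \<subseteq> cosets_in_ball centre 3"
    using mem u v by simp
  moreover have "finite (cosets_in_ball centre 3)" by (simp add: cosets_in_ball_def)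
  ultimately show ?thesis using card_mono by metis
qed

text \<open>Gustafson's argument: the centre has density at most \<open>1/4\<close> and every other centralizer
  density at most \<open>1/2\<close>, so the commuting probability is at most
  \<open>1/4 + 3/4 \<cdot> 1/2 = 5/8\<close>.\<close>
lemma card_commuting_pairs_le:
  assumes nonabelian: "u \<in> carrier G" "v \<in> carrier G" "u \<otimes> v \<noteq> v \<otimes> u"
    and e: "0 < e" "e \<le> 1" and growth: "real (card (ball (n + 3))) \<le> (1 + e) * real (card (ball n))"
  shows "real (card (commuting_pairs n)) \<le> (5 / 8 + e / 2) * (real (card (ball n)))\<^sup>2"
proof -
  define b where "b = real (card (ball n))"
  define z where "z = real (card (centre \<inter> ball n))"
  define c where "c = (1 + e) / 2 * b"
  have b: "b > 0" using card_ball_pos by (simp add: b_def)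
  have "card (centre \<inter> ball n) * 4 \<le> card (centre \<inter> ball n) * card (cosets_in_ball centre 3)"
    using card_cosets_centre[OF nonabelian] by simp
  also have "\<dots> \<le> card (ball (n + 3))" by (rule card_inter_times_cosets[OF subgroup_centre])
  finally have "real (card (centre \<inter> ball n) * 4) \<le> real (card (ball (n + 3)))"
    by (rule of_nat_mono)
  then have z: "z \<le> (1 + e) / 4 * b" using growth by (simp add: z_def b_def)
  have cent: "real (card (centralizer x \<inter> ball n)) \<le> c" if x: "x \<in> ball n" "x \<notin> centre" for x
  proof -
    have xc: "x \<in> carrier G" using x ball_closed by blast
    then obtain g where g: "g \<in> carrier G" "x \<otimes> g \<noteq> g \<otimes> x" using x(2) unfolding centre_def by blast
    then have "g \<notin> centralizer x" unfolding centralizer_def by force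
    \<comment> \<open>A proper subgroup is not syndetic at radius 0, so at least two of its cosets
      meet \<open>ball 1\<close>.\<close>
    then have "\<not> syndetic (centralizer x) 0"
      using g(1) unfolding syndetic_def by (auto simp: ball_0)
    from card_cosets_in_ball[OF subgroup_centralizer[OF xc] this]
    have "card (centralizer x \<inter> ball n) * 2
        \<le> card (centralizer x \<inter> ball n) * card (cosets_in_ball (centralizer x) 1)" by simp
    also have "\<dots> \<le> card (ball (n + 1))"
      by (rule card_inter_times_cosets[OF subgroup_centralizer[OF xc]])
    also have "\<dots> \<le> card (ball (n + 3))" by (rule card_ball_mono) simp
    finally have "real (card (centralizer x \<inter> ball n) * 2) \<le> real (card (ball (n + 3)))"
      by (rule of_nat_mono)
    then show ?thesis using growth by (simp add: c_def b_def)
  qed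
  have "real (card (commuting_pairs n)) = (\<Sum>x\<in>ball n. real (card (centralizer x \<inter> ball n)))"
    by (simp add: card_commuting_pairs)
  also have "\<dots> \<le> (\<Sum>x\<in>ball n. (if x \<in> centre then b - c else 0) + c)"
  proof (rule sum_mono)
    fix x assume x: "x \<in> ball n"
    have "real (card (centralizer x \<inter> ball n)) \<le> b" unfolding b_def by (simp add: card_mono)
    then show "real (card (centralizer x \<inter> ball n)) \<le> (if x \<in> centre then b - c else 0) + c"
      using cent[OF x] by simp
  qed
  also have "\<dots> = z * (b - c) + b * c"
    by (simp add: sum.distrib sum.If_cases z_def b_def Int_commute)
  \<comment> \<open>The sum increases with \<open>z\<close> because \<open>c \<le> b\<close>, which
    is where \<open>e \<le> 1\<close> enters.\<close>
  also have "\<dots> \<le> ((1 + e) / 4 * b) * (b - c) + b * c"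
    using z e b by (intro add_right_mono mult_right_mono) (auto simp: c_def field_simps)
  also have "\<dots> = (5 / 8 + e / 2) * b\<^sup>2 - e\<^sup>2 / 8 * b\<^sup>2"
    by (simp add: c_def power2_eq_square field_simps)
  also have "\<dots> \<le> (5 / 8 + e / 2) * b\<^sup>2" by simp
  finally show ?thesis by (simp add: b_def)
qed

section \<open>Virtual abelianness from positive degree, commutativity from degree above 5/8, and
  the converses\<close>

text \<open>At a doubling scale \<open>r\<close> beyond \<open>k\<close>,
  \<open>ball (r + k)\<close> is at most \<open>K\<close> times as large as \<open>ball r\<close>,
  so \<open>H\<close> fills at least the fraction 1/(K card (ball k)) of it. All pairs from
  \<open>H\<close> commute, and the square of this fraction bounds the commuting pairs from
  below.\<close>

lemma many_commuting_if_syndetic_abelian: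
  assumes K: "doubling_scales K" and H: "syndetic H k"
    and comm: "\<And>x y. x \<in> H \<Longrightarrow> y \<in> H \<Longrightarrow> x \<otimes> y = y \<otimes> x"
  shows "\<exists>e>0. \<exists>\<^sub>F n in sequentially. e * (real (card (ball n)))\<^sup>2 \<le> real (card (commuting_pairs n))"
proof -
  let ?b = "\<lambda>n. real (card (ball n))"
  define e where "e = 1 / (K * ?b k)"
  have Kpos: "K > 0" by (rule doubling_scales_pos[OF K])
  have e: "e > 0" using Kpos card_ball_pos[of k] by (simp add: e_def)
  have "\<exists>n\<ge>N. e\<^sup>2 * (?b n)\<^sup>2 \<le> real (card (commuting_pairs n))" for N
  proof -
    obtain r where r: "r \<ge> max N k" "?b (6 * r) \<le> K * ?b r"
      using K unfolding doubling_scales_def by blast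
    define n where "n = r + k"
    have n: "n \<ge> N" "n \<le> 6 * r" using r(1) by (auto simp: n_def)
    have "?b n \<le> ?b (6 * r)" using card_ball_mono[OF n(2)] by simp
    also have "\<dots> \<le> K * ?b r" by (rule r(2))
    also have "\<dots> \<le> K * (?b k * real (card (H \<inter> ball n)))"
      using card_ball_le_syndetic[OF H, of r] Kpos
      by (intro mult_left_mono) (simp_all add: n_def flip: of_nat_mult)
    finally have "e * ?b n \<le> real (card (H \<inter> ball n))"
      using Kpos card_ball_pos[of k] by (simp add: e_def field_simps)
    then have "(e * ?b n)\<^sup>2 \<le> (real (card (H \<inter> ball n)))\<^sup>2"
      using e by (intro power_mono) auto
    also have "\<dots> = real (card ((H \<inter> ball n) \<times> (H \<inter> ball n)))"
      by (simp add: card_cartesian_product power2_eq_square)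
    also have "\<dots> \<le> real (card (commuting_pairs n))"
    proof (intro of_nat_mono card_mono)
      show "finite (commuting_pairs n)"
        by (rule finite_subset[of _ "ball n \<times> ball n"]) (auto simp: commuting_pairs_def)
      show "(H \<inter> ball n) \<times> (H \<inter> ball n) \<subseteq> commuting_pairs n"
        using comm unfolding commuting_pairs_def by blast
    qed
    finally show ?thesis using n(1) by (auto simp: power_mult_distrib)
  qed
  then show ?thesis
    using e unfolding frequently_sequentially by (intro exI[of _ "e\<^sup>2"]) simp
qed

lemma syndetic_fc_kernel_if_degree_pos:
  assumes "doubling_scales K" "degree_of_commutativity G X > 0"
  shows "\<exists>k. syndetic fc_kernel k"
proof -
  obtain e where e: "e > 0"
    "\<exists>\<^sub>F n in sequentially. e * (real (card (ball n)))\<^sup>2 \<le> real (card (commuting_pairs n))"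
    using assms(2) degree_of_commutativity_gt_iff[of 0] by (auto simp: zero_ereal_def)
  then show ?thesis
    using syndetic_fc_kernel_if_many_commuting[OF assms(1), of "e / 2"] by simp
qed

lemma degree_pos_iff_virtually_abelian:
  assumes K: "doubling_scales K"
  shows "degree_of_commutativity G X > 0 \<longleftrightarrow> virtually_abelian G"
proof
  assume "degree_of_commutativity G X > 0"
  then obtain k where k: "syndetic fc_kernel k"
    using syndetic_fc_kernel_if_degree_pos[OF K] by blast
  have sub: "subgroup fc_kernel G" using normal_fc_kernel by (rule normal_imp_subgroup)
  have "comm_group (G\<lparr>carrier := fc_kernel\<rparr>)"
    using group.group_comm_groupI[OF subgroup_imp_group[OF sub]] fc_kernel_comm by simp
  moreover have "finite (rcosets fc_kernel)"
    using k syndetic_iff_finite_rcosets[OF sub] by blast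
  ultimately show "virtually_abelian G" using sub unfolding virtually_abelian_def by blast
next
  assume "virtually_abelian G"
  then obtain H where H: "subgroup H G" "comm_group (G\<lparr>carrier := H\<rparr>)" "finite (rcosets H)"
    unfolding virtually_abelian_def by blast
  then obtain k where k: "syndetic H k" using syndetic_iff_finite_rcosets by blast
  have "x \<otimes> y = y \<otimes> x" if "x \<in> H" "y \<in> H" for x y
  proof -
    interpret H: comm_group "G\<lparr>carrier := H\<rparr>" by (rule H(2))
    show ?thesis using H.m_comm[of x y] that by simp
  qed
  from many_commuting_if_syndetic_abelian[OF K k this]
  show "degree_of_commutativity G X > 0"
    using degree_of_commutativity_gt_iff[of 0] by (simp add: zero_ereal_def)
qed

lemma degree_gt_five_eighths_iff_comm_group:
  assumes K: "doubling_scales K"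
  shows "degree_of_commutativity G X > ereal (5 / 8) \<longleftrightarrow> comm_group G"
proof
  assume gt: "degree_of_commutativity G X > ereal (5 / 8)"
  then obtain e where e: "e > 0" and many: "\<exists>\<^sub>F n in sequentially.
      (5 / 8 + e) * (real (card (ball n)))\<^sup>2 \<le> real (card (commuting_pairs n))"
    using degree_of_commutativity_gt_iff by blast
  have "degree_of_commutativity G X > 0"
    by (rule less_trans[OF _ gt]) simp
  then obtain k where k: "syndetic fc_kernel k"
    using syndetic_fc_kernel_if_degree_pos[OF K] by blast
  obtain L C where half: "\<forall>n. card (ball n) \<le> L * card (ball (n div 2 + C))"
    using ball_halving[OF normal_fc_kernel fc_kernel_comm k] by blast
  \<comment> \<open>\<open>card_commuting_pairs_le\<close> takes a slack of at most 1, and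
    \<open>d \<le> e\<close> puts its bound \<open>5 / 8 + d / 2\<close> strictly below
    \<open>5 / 8 + e\<close>.\<close>
  define d where "d = min e 1"
  have d: "0 < d" "d \<le> 1" "d \<le> e" using e by (auto simp: d_def)
  obtain N where N: "\<And>n. n \<ge> N \<Longrightarrow> real (card (ball (n + 3))) \<le> (1 + d) * real (card (ball n))"
    using ball_growth_negligible[OF half d(1)] by blast
  obtain n where n: "n \<ge> N"
    "(5 / 8 + e) * (real (card (ball n)))\<^sup>2 \<le> real (card (commuting_pairs n))"
    using many unfolding frequently_sequentially by blast
  have "u \<otimes> v = v \<otimes> u" if "u \<in> carrier G" "v \<in> carrier G" for u v
  proof (rule ccontr)
    assume "u \<otimes> v \<noteq> v \<otimes> u"
    from card_commuting_pairs_le[OF that this d(1,2) N[OF n(1)]] n(2)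
    have "(5 / 8 + e) * (real (card (ball n)))\<^sup>2 \<le> (5 / 8 + d / 2) * (real (card (ball n)))\<^sup>2"
      by linarith
    then have "5 / 8 + e \<le> 5 / 8 + d / 2" using card_ball_pos[of n] by simp
    then show False using d by linarith
  qed
  then show "comm_group G" by (rule group_comm_groupI)
next
  assume "comm_group G"
  then interpret comm_group G .
  have "commuting_pairs n = ball n \<times> ball n" for n
    using ball_closed m_comm unfolding commuting_pairs_def by blast
  \<comment> \<open>All pairs commute, so the ratio is 1, which exceeds 5/8 by the slack
    \<open>3 / 8\<close>.\<close>
  then have "(5 / 8 + 3 / 8) * (real (card (ball n)))\<^sup>2 \<le> real (card (commuting_pairs n))" for n
    by (simp add: card_cartesian_product power2_eq_square)
  then have "\<exists>\<^sub>F n in sequentially.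
      (5 / 8 + 3 / 8) * (real (card (ball n)))\<^sup>2 \<le> real (card (commuting_pairs n))"
    by (simp add: eventually_frequently)
  moreover have "(3 / 8 :: real) > 0" by simp
  ultimately show "degree_of_commutativity G X > ereal (5 / 8)"
    unfolding degree_of_commutativity_gt_iff by blast
qed

end

theorem corollary1p7:
  fixes G :: "('a, 'b) monoid_scheme" and X :: "'a set"
  assumes "group G"
    and "polynomial_growth G"
    and "finite_generating_set G X"
  shows "(degree_of_commutativity G X > 0 \<longleftrightarrow> virtually_abelian G)
       \<and> (degree_of_commutativity G X > ereal (5 / 8) \<longleftrightarrow> comm_group G)"
proof -
  interpret fg_group G X
    using assms(1,3) by (simp add: fg_group_def fg_group_axioms_def)
  obtain K where "doubling_scales K"
    using polynomial_growth_imp_doubling_scales[OF assms(2)] .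
  then show ?thesis
    using degree_pos_iff_virtually_abelian degree_gt_five_eighths_iff_comm_group by blast
qed

end
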